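(* Let $\mathfrak{A}$ and $\mathfrak{B}$ be compact $C^*$-algebras, and let $\Phi\colon\mathfrak{A}\to\mathfrak{B}$ be a linear strong BJ isomorphism. Then there exist nonzero scalars $\alpha,\beta\in\mathbb{C}$, a $*$-isomorphism $\Psi\colon\mathfrak{A}\to\mathfrak{B}$ and unitary elements $V\in\mathcal{M}(\mathfrak{A})$ and $W\in\mathcal{M}(\mathfrak{B})$ such that $\Phi(x)=\alpha\Psi(Vx)=\beta W\Psi(x)$ for each $x\in\mathfrak{A}$.
   Context: A $C^*$-algebra is compact if it is $*$-isomorphic to a $C^*$-subalgebra of the algebra of compact operators on some complex Hilbert space. For elements $x,y$ of a $C^*$-algebra $\mathfrak{A}$, $x\perp_{BJ}^s y$ means $\|x+yz\|\ge\|x\|$ for each $z\in\mathfrak{A}$. A map $\Phi\colon\mathfrak{A}\to\mathfrak{B}$ between $C^*$-algebras is a strong BJ isomorphism if it is bijective and, for all $x,y\in\mathfrak{A}$, $x\perp_{BJ}^s y$ if and only if $\Phi(x)\perp_{BJ}^s\Phi(y)$. $\mathcal{M}(\mathfrak{B})$ denotes the multiplier algebra of $\mathfrak{B}$: if $\mathfrak{B}$ is represented nondegenerately on a Hilbert space $\mathcal{H}$, then $\mathcal{M}(\mathfrak{B})=\{X\in\mathcal{B}(\mathcal{H}): X\mathfrak{B}\subseteq\mathfrak{B}\text{ and }\mathfrak{B}X\subseteq\mathfrak{B}\}$. *)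

theory Defs
  imports "HOL-Analysis.Analysis"
begin

section \<open>Complex vector spaces, Hilbert spaces and C*-algebras\<close>

class scaleC =
  fixes scaleC :: "complex \<Rightarrow> 'a \<Rightarrow> 'a"  (infixr \<open>*\<^sub>C\<close> 75)

class complex_vector = real_vector + scaleC +
  assumes scaleC_add_right: "c *\<^sub>C (x + y) = c *\<^sub>C x + c *\<^sub>C y"
    and scaleC_add_left: "(c + d) *\<^sub>C x = c *\<^sub>C x + d *\<^sub>C x"
    and scaleC_scaleC: "c *\<^sub>C (d *\<^sub>C x) = (c * d) *\<^sub>C x"
    and scaleC_one: "1 *\<^sub>C x = x"
    and scaleR_scaleC: "r *\<^sub>R x = complex_of_real r *\<^sub>C x"

text \<open>
  The complex inner product is linear in the first argument. Positive definiteness and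
  the formula for the norm are inherited from the class of real inner product spaces,
  whose inner product is required to be the real part of the complex one.
\<close>

class chilbert_space = complex_vector + real_inner + complete_space +
  fixes cinner :: "'a \<Rightarrow> 'a \<Rightarrow> complex"
  assumes cinner_add_left: "cinner (x + y) z = cinner x z + cinner y z"
    and cinner_scaleC_left: "cinner (c *\<^sub>C x) y = c * cinner x y"
    and cinner_commute: "cinner x y = cnj (cinner y x)"
    and inner_eq_Re_cinner: "inner x y = Re (cinner x y)"

text \<open>C*-algebras are not assumed to be unital.\<close>

class cstar_algebra = complex_vector + real_normed_algebra + complete_space +
  fixes star :: "'a \<Rightarrow> 'a"
  assumes norm_scaleC: "norm (c *\<^sub>C x) = cmod c * norm x"
    and mult_scaleC_left: "(c *\<^sub>C x) * y = c *\<^sub>C (x * y)"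
    and mult_scaleC_right: "x * (c *\<^sub>C y) = c *\<^sub>C (x * y)"
    and star_star: "star (star x) = x"
    and star_add: "star (x + y) = star x + star y"
    and star_scaleC: "star (c *\<^sub>C x) = cnj c *\<^sub>C star x"
    and star_mult: "star (x * y) = star y * star x"
    and cstar_identity: "norm (star x * x) = (norm x)\<^sup>2"

definition clinear :: "('a::complex_vector \<Rightarrow> 'b::complex_vector) \<Rightarrow> bool" where
  "clinear f \<longleftrightarrow> (\<forall>x y. f (x + y) = f x + f y) \<and> (\<forall>c x. f (c *\<^sub>C x) = c *\<^sub>C f x)"

definition star_isomorphism :: "('a::cstar_algebra \<Rightarrow> 'b::cstar_algebra) \<Rightarrow> bool" where
  "star_isomorphism f \<longleftrightarrow> bij f \<and> clinear f \<and>
     (\<forall>x y. f (x * y) = f x * f y) \<and> (\<forall>x. f (star x) = star (f x))"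


section \<open>Operators on a complex Hilbert space\<close>

text \<open>
  The library type of bounded operators consists of real-linear maps, so complex
  homogeneity has to be imposed; the operator norm is the same.
\<close>

definition bounded_ops :: "('h::chilbert_space \<Rightarrow>\<^sub>L 'h) set" where
  "bounded_ops = {T. clinear (blinfun_apply T)}"

definition is_adjoint :: "('h::chilbert_space \<Rightarrow>\<^sub>L 'h) \<Rightarrow> ('h \<Rightarrow>\<^sub>L 'h) \<Rightarrow> bool" where
  "is_adjoint T S \<longleftrightarrow>
     (\<forall>u v. cinner (blinfun_apply T u) v = cinner u (blinfun_apply S v))"

text \<open>
  The library's type of bounded operators has no multiplication by complex scalars;
  \<open>is_cscaled c T S\<close> says that \<open>S\<close> is \<open>c\<close> times \<open>T\<close>.
\<close>

definition is_cscaled ::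
    "complex \<Rightarrow> ('h::chilbert_space \<Rightarrow>\<^sub>L 'h) \<Rightarrow> ('h \<Rightarrow>\<^sub>L 'h) \<Rightarrow> bool" where
  "is_cscaled c T S \<longleftrightarrow> (\<forall>u. blinfun_apply S u = c *\<^sub>C blinfun_apply T u)"

definition compact_ops :: "('h::chilbert_space \<Rightarrow>\<^sub>L 'h) set" where
  "compact_ops = {T \<in> bounded_ops. compact (closure (blinfun_apply T ` cball 0 1))}"

definition cstar_subalgebra :: "('h::chilbert_space \<Rightarrow>\<^sub>L 'h) set \<Rightarrow> bool" where
  "cstar_subalgebra S \<longleftrightarrow> S \<subseteq> bounded_ops \<and> closed S \<and> 0 \<in> S \<and>
     (\<forall>T\<in>S. \<forall>R\<in>S. T + R \<in> S \<and> T o\<^sub>L R \<in> S) \<and>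
     (\<forall>T\<in>S. \<forall>c. \<exists>R\<in>S. is_cscaled c T R) \<and>
     (\<forall>T\<in>S. \<exists>R\<in>S. is_adjoint T R)"

definition unitary_op :: "('h::chilbert_space \<Rightarrow>\<^sub>L 'h) \<Rightarrow> bool" where
  "unitary_op U \<longleftrightarrow> U \<in> bounded_ops \<and>
     (\<exists>S. is_adjoint U S \<and> S o\<^sub>L U = id_blinfun \<and> U o\<^sub>L S = id_blinfun)"


section \<open>Representations, compact C*-algebras, multiplier algebras\<close>

definition star_representation ::
    "('a::cstar_algebra \<Rightarrow> ('h::chilbert_space \<Rightarrow>\<^sub>L 'h)) \<Rightarrow> bool" where
  "star_representation \<pi> \<longleftrightarrow> range \<pi> \<subseteq> bounded_ops \<and>
     (\<forall>x y. \<pi> (x + y) = \<pi> x + \<pi> y) \<and>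
     (\<forall>c x. is_cscaled c (\<pi> x) (\<pi> (c *\<^sub>C x))) \<and>
     (\<forall>x y. \<pi> (x * y) = \<pi> x o\<^sub>L \<pi> y) \<and>
     (\<forall>x. is_adjoint (\<pi> x) (\<pi> (star x)))"

text \<open>
  A C*-algebra is compact if \<open>compact_cstar_algebra TYPE('a) TYPE('h)\<close> holds for some
  Hilbert space \<open>'h\<close>. There is no quantification over types, so the space is a parameter;
  it becomes universally quantified when the predicate is used as a hypothesis.
\<close>

definition compact_cstar_algebra ::
    "'a::cstar_algebra itself \<Rightarrow> 'h::chilbert_space itself \<Rightarrow> bool" where
  "compact_cstar_algebra _ _ \<longleftrightarrow>
     (\<exists>S (\<pi> :: 'a \<Rightarrow> ('h \<Rightarrow>\<^sub>L 'h)). cstar_subalgebra S \<and> S \<subseteq> compact_ops \<and>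
        star_representation \<pi> \<and> bij_betw \<pi> UNIV S)"

text \<open>
  Only real linear combinations are taken in the span; since the vectors \<open>\<pi> x u\<close> are closed
  under multiplication by complex scalars, it is also their complex linear span.
\<close>

definition nondegenerate ::
    "('a::cstar_algebra \<Rightarrow> ('h::chilbert_space \<Rightarrow>\<^sub>L 'h)) \<Rightarrow> bool" where
  "nondegenerate \<pi> \<longleftrightarrow> closure (span {blinfun_apply (\<pi> x) u | x u. True}) = UNIV"

definition faithful_nondegenerate_rep ::
    "('a::cstar_algebra \<Rightarrow> ('h::chilbert_space \<Rightarrow>\<^sub>L 'h)) \<Rightarrow> bool" where
  "faithful_nondegenerate_rep \<pi> \<longleftrightarrow> star_representation \<pi> \<and> inj \<pi> \<and> nondegenerate \<pi>"

definition multiplier_algebra ::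
    "('a::cstar_algebra \<Rightarrow> ('h::chilbert_space \<Rightarrow>\<^sub>L 'h)) \<Rightarrow> ('h \<Rightarrow>\<^sub>L 'h) set" where
  "multiplier_algebra \<pi> =
     {X \<in> bounded_ops. \<forall>T\<in>range \<pi>. X o\<^sub>L T \<in> range \<pi> \<and> T o\<^sub>L X \<in> range \<pi>}"

text \<open>
  The product of a multiplier \<open>X\<close> and an element \<open>x\<close>, as an element of the abstract algebra:
  the algebra is identified with its image under the injective representation \<open>\<pi>\<close>.
\<close>

definition multiplier_mult ::
    "('a::cstar_algebra \<Rightarrow> ('h::chilbert_space \<Rightarrow>\<^sub>L 'h)) \<Rightarrow> ('h \<Rightarrow>\<^sub>L 'h) \<Rightarrow> 'a \<Rightarrow> 'a" where
  "multiplier_mult \<pi> X x = inv \<pi> (X o\<^sub>L \<pi> x)"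


section \<open>Strong Birkhoff--James orthogonality\<close>

definition strong_BJ_orthogonal :: "'a::cstar_algebra \<Rightarrow> 'a \<Rightarrow> bool" where
  "strong_BJ_orthogonal x y \<longleftrightarrow> (\<forall>z. norm (x + y * z) \<ge> norm x)"

definition strong_BJ_isomorphism :: "('a::cstar_algebra \<Rightarrow> 'b::cstar_algebra) \<Rightarrow> bool" where
  "strong_BJ_isomorphism \<Phi> \<longleftrightarrow> bij \<Phi> \<and>
     (\<forall>x y. strong_BJ_orthogonal x y \<longleftrightarrow> strong_BJ_orthogonal (\<Phi> x) (\<Phi> y))"

end

theory Submission
  imports Defs
begin

text \<open>
  The point is that a linear strong BJ isomorphism \<open>\<Phi>\<close> satisfies, for some \<open>c > 0\<close>,
  the ternary identity \<open>\<Phi> z (\<Phi> x)* \<Phi> y = c \<Phi> (z x* y)\<close>. Everything else follows from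
  this: the rule \<open>(\<Phi> x)* \<Phi> y = c \<Psi> (x* y)\<close> then defines a *-isomorphism \<open>\<Psi>\<close>, and the
  maps \<open>L = (1/sqrt c) \<Psi>\<^sup>-\<^sup>1 \<Phi>\<close> and \<open>M = (1/sqrt c) \<Phi> \<Psi>\<^sup>-\<^sup>1\<close> preserve the products \<open>x* y\<close>. A
  bijection with this property is left multiplication by a unitary multiplier in every faithful
  nondegenerate representation, because \<open>\<pi> x u \<mapsto> \<pi> (L x) u\<close> preserves inner products
  (lemma \<open>unitary_multiplier\<close>).

  The tool throughout is a minimal projection, a projection \<open>e \<noteq> 0\<close> with \<open>e A e = \<complex> e\<close>. In a
  compact algebra there are enough of them: for \<open>x \<noteq> 0\<close> some minimal \<open>q\<close> satisfies
  \<open>\<parallel>x q\<parallel> = \<parallel>\<pi> x\<parallel>\<close>, where \<open>\<pi>\<close> is a faithful compact representation. Such a \<open>q\<close> lies below the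
  norm limit of the powers of \<open>\<pi> (x* x)\<close>, scaled to norm 1.

  Strong orthogonality sees ranges. If \<open>x* y = 0\<close> then \<open>x\<close> is strongly orthogonal to \<open>y\<close>;
  conversely, if \<open>w = w q\<close> with \<open>q\<close> minimal and \<open>y* w \<noteq> 0\<close>, a step in the direction
  \<open>- y y* w\<close> shortens \<open>w\<close>. Therefore \<open>x* y = 0\<close> can be expressed by strong orthogonality alone
  (lemma \<open>star_mult_eq_0_iff_strong_BJ\<close>), and \<open>\<Phi>\<close> preserves it in both directions.

  The relation \<open>x* y = 0\<close> in turn knows left multiplication. For a projection \<open>e\<close> the elements
  \<open>e x\<close> and \<open>y - e y\<close> have orthogonal ranges, and so do \<open>x - e x\<close> and \<open>e y\<close>; hence
  \<open>(\<Phi> (e x))* \<Phi> y = (\<Phi> x)* \<Phi> (e y)\<close>, which makes \<open>\<Phi> x \<mapsto> \<Phi> (e x)\<close> a self-adjoint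
  idempotent right module map. For minimal \<open>e\<close> it is left multiplication by a minimal projection
  of the target (lemma \<open>minproj_image\<close>).

  Up to here \<open>\<Phi>\<close> could still be followed by right multiplication by an invertible element. What
  excludes this is the quantitative content of strong orthogonality: for orthogonal minimal \<open>e\<close>
  and \<open>f\<close> the element \<open>e + f\<close> is strongly orthogonal to \<open>e\<close> and to \<open>f\<close>, so \<open>\<Phi> e + \<Phi> f\<close> has
  norm at most \<open>min \<parallel>\<Phi> e\<parallel> \<parallel>\<Phi> f\<parallel>\<close>. That is only possible if \<open>\<Phi> e (\<Phi> f)* = 0\<close> and
  \<open>\<parallel>\<Phi> e\<parallel> = \<parallel>\<Phi> f\<parallel>\<close> (lemma \<open>orthogonal_minproj\<close>). From this the ternary identity is obtained
  first with a minimal projection in the middle, then with one on the left, then in general, with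
  \<open>c = \<parallel>\<Phi> e\<parallel>\<^sup>2\<close> for every minimal \<open>e\<close>. At the outset \<open>\<Phi>\<close> is not known to be bounded, so the
  derivation of the identity has to be algebraic; only the identity shows that \<open>\<Phi>\<close> is a multiple of
  an isometry for the operator norms, and then \<open>\<Psi>\<close> extends from products to their limits.
\<close>

section \<open>Complex scalars and the involution\<close>

lemma scaleC_zero_left [simp]: "0 *\<^sub>C (x::'a::complex_vector) = 0"
  using scaleC_add_left[of 0 0 x] by simp

lemma scaleC_zero_right [simp]: "c *\<^sub>C (0::'a::complex_vector) = 0"
  using scaleC_add_right[of c "0::'a" 0] by simp

lemma scaleC_minus_left: "(- c) *\<^sub>C (x::'a::complex_vector) = - (c *\<^sub>C x)"
  using scaleC_add_left[of "- c" c x] by (simp add: eq_neg_iff_add_eq_0)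

lemma scaleC_minus_right: "c *\<^sub>C (- x::'a::complex_vector) = - (c *\<^sub>C x)"
  using scaleC_add_right[of c "- x" x] by (simp add: eq_neg_iff_add_eq_0)

lemma scaleC_diff_right: "c *\<^sub>C (x - y::'a::complex_vector) = c *\<^sub>C x - c *\<^sub>C y"
  using scaleC_add_right[of c x "- y"] by (simp add: scaleC_minus_right)

lemma scaleC_eq_0_iff [simp]: "c *\<^sub>C (x::'a::complex_vector) = 0 \<longleftrightarrow> c = 0 \<or> x = 0"
proof
  assume z: "c *\<^sub>C x = 0"
  show "c = 0 \<or> x = 0"
  proof (cases "c = 0")
    case False
    have "x = (inverse c * c) *\<^sub>C x" using False by (simp add: scaleC_one)
    also have "\<dots> = inverse c *\<^sub>C (c *\<^sub>C x)" by (simp add: scaleC_scaleC)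
    finally show ?thesis using z by simp
  qed simp
qed auto

lemma scaleC_cancel_right:
  "c *\<^sub>C (x::'a::complex_vector) = d *\<^sub>C x \<Longrightarrow> x \<noteq> 0 \<Longrightarrow> c = d"
proof -
  assume h: "c *\<^sub>C x = d *\<^sub>C x" "x \<noteq> 0"
  have "(c - d) *\<^sub>C x = c *\<^sub>C x + (- d) *\<^sub>C x" by (simp add: scaleC_add_left[symmetric])
  also have "\<dots> = 0" using h by (simp add: scaleC_minus_left)
  finally show "c = d" using h by simp
qed

lemma scaleC_of_real: "complex_of_real r *\<^sub>C (x::'a::complex_vector) = r *\<^sub>R x"
  by (simp add: scaleR_scaleC)

lemma star_zero [simp]: "star (0::'a::cstar_algebra) = 0"
  using star_add[of "0::'a" 0] by simp

lemma star_minus: "star (- x::'a::cstar_algebra) = - star x"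
  using star_add[of "- x" x] by (simp add: eq_neg_iff_add_eq_0)

lemma star_diff: "star (x - y::'a::cstar_algebra) = star x - star y"
  using star_add[of x "- y"] by (simp add: star_minus)

lemma star_scaleR: "star (r *\<^sub>R x::'a::cstar_algebra) = r *\<^sub>R star x"
  by (simp add: scaleR_scaleC star_scaleC)

lemma norm_star [simp]: "norm (star x::'a::cstar_algebra) = norm x"
proof -
  have le: "norm y \<le> norm (star y)" for y :: 'a
  proof (cases "y = 0")
    case False
    have "norm y * norm y \<le> norm (star y) * norm y"
      using cstar_identity[of y] norm_mult_ineq[of "star y" y] by (simp add: power2_eq_square)
    then show ?thesis using False by simp
  qed simp
  from le[of x] le[of "star x"] show ?thesis by (simp add: star_star)
qed

lemma star_mult_self_eq_0 [simp]: "star x * x = 0 \<longleftrightarrow> (x::'a::cstar_algebra) = 0"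
proof
  assume "star x * x = 0"
  then have "norm (star x * x) = 0" by simp
  then show "x = 0" by (simp add: cstar_identity)
qed simp

lemma mult_star_self_eq_0 [simp]: "x * star x = 0 \<longleftrightarrow> (x::'a::cstar_algebra) = 0"
proof -
  have "x * star x = 0 \<longleftrightarrow> star x = 0"
    using star_mult_self_eq_0[of "star x"] by (simp add: star_star)
  also have "\<dots> \<longleftrightarrow> x = 0" by (metis star_star star_zero)
  finally show ?thesis .
qed

lemma star_mult_eq_0_comm: "star x * y = 0 \<longleftrightarrow> star y * x = (0::'a::cstar_algebra)"
  by (metis star_mult star_star star_zero)

lemma eq_if_all_left_mult_eq:
  fixes x y :: "'a::cstar_algebra"
  assumes "\<And>z. star z * x = star z * y"
  shows "x = y"
proof -
  have "star (x - y) * (x - y) = 0" using assms[of "x - y"] by (simp add: right_diff_distrib)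
  then show ?thesis by simp
qed

text \<open>
  Besides recovering products from squares, this shows below that the elements of \<open>A e\<close> are
  complex combinations of positive elements, and that a corner in which all squares are scalar is
  itself scalar.
\<close>

lemma polarization:
  fixes x y :: "'a::cstar_algebra"
  defines "s \<equiv> \<lambda>u. star u * u"
  shows "4 *\<^sub>C (star x * y) = s (x + y) + (- 1) *\<^sub>C s (x + (- 1) *\<^sub>C y)
           + (- \<i>) *\<^sub>C s (x + \<i> *\<^sub>C y) + \<i> *\<^sub>C s (x + (- \<i>) *\<^sub>C y)"
proof -
  have four: "4 *\<^sub>C (star x * y) = star x * y + star x * y + star x * y + star x * y"
    using scaleC_add_left[of 2 2 "star x * y"] scaleC_add_left[of 1 1 "star x * y"]
    by (simp add: scaleC_one)
  have s: "s (x + c *\<^sub>C y) = star x * x + c *\<^sub>C (star x * y) + cnj c *\<^sub>C (star y * x)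
             + (cnj c * c) *\<^sub>C (star y * y)" for c
    by (simp add: s_def star_add star_scaleC algebra_simps mult_scaleC_left mult_scaleC_right
        scaleC_scaleC scaleC_add_right)
  show ?thesis
    unfolding four s s[of 1, unfolded scaleC_one]
    by (simp add: scaleC_one scaleC_add_right scaleC_diff_right scaleC_scaleC scaleC_minus_left
        scaleC_minus_right)
qed

section \<open>Minimal projections\<close>

definition minproj :: "'a::cstar_algebra \<Rightarrow> bool" where
  "minproj e \<longleftrightarrow> e \<noteq> 0 \<and> star e = e \<and> e * e = e \<and> (\<forall>a. \<exists>c. e * a * e = c *\<^sub>C e)"

lemma minprojD:
  assumes "minproj e"
  shows "e \<noteq> 0" "star e = e" "e * e = e"
  using assms by (auto simp: minproj_def)

lemma norm_projection:
  fixes e :: "'a::cstar_algebra"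
  assumes "e \<noteq> 0" "star e = e" "e * e = e"
  shows "norm e = 1"
proof -
  have "norm e = norm e * norm e"
    using cstar_identity[of e] assms by (simp add: power2_eq_square)
  then show ?thesis using assms by simp
qed

text \<open>
  Minimality only gives \<open>x* x = t e\<close> for some complex \<open>t\<close>; what has to be shown is that \<open>t\<close> is
  not negative. For \<open>t < 0\<close> the quadratic polynomial by which
  \<open>(x + r e)* (x + r e)\<close> is a multiple of \<open>e\<close> has a real root \<open>r\<close>, and then \<open>x = - r e\<close>, whose
  square is a nonnegative multiple of \<open>e\<close>.
\<close>

lemma minproj_star_mult:
  fixes x :: "'a::cstar_algebra"
  assumes e: "minproj e" and x: "x * e = x"
  shows "star x * x = (norm x)\<^sup>2 *\<^sub>R e"
proof -
  note eD = minprojD[OF e]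
  have ex: "e * star x = star x" using x eD by (metis star_mult)
  obtain c where "e * (star x * x) * e = c *\<^sub>C e" using e by (auto simp: minproj_def)
  then have c: "star x * x = c *\<^sub>C e" using x ex by (simp add: mult.assoc[symmetric]) (metis mult.assoc x)
  have "cnj c *\<^sub>C e = c *\<^sub>C e"
    using c by (metis eD(2) star_mult star_scaleC star_star)
  then have "cnj c = c" using scaleC_cancel_right eD by blast
  then obtain t where t: "c = complex_of_real t"
    by (metis complex_cnj_cnj complex_is_Real_iff Reals_cases Reals_cnj_iff)
  have c': "star x * x = t *\<^sub>R e" using c t by (simp add: scaleC_of_real)
  obtain k where "e * x * e = k *\<^sub>C e" using e by (auto simp: minproj_def)
  then have k: "e * x = k *\<^sub>C e" using x by (simp add: mult.assoc)
  then have k': "star x * e = cnj k *\<^sub>C e"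
    using eD by (metis star_mult star_scaleC)
  have t0: "t \<ge> 0"
  proof (rule ccontr)
    assume "\<not> t \<ge> 0"
    \<comment> \<open>\<open>r\<close> is a root of \<open>r\<^sup>2 + 2 (Re k) r + t\<close>, which is real because \<open>t < 0\<close>.\<close>
    define d where "d = sqrt ((Re k)\<^sup>2 - t)"
    define r where "r = d - Re k"
    have "d\<^sup>2 = (Re k)\<^sup>2 - t" unfolding d_def using \<open>\<not> t \<ge> 0\<close>
      by (intro real_sqrt_pow2) (smt (verit) zero_le_power2)
    then have root: "t + 2 * r * Re k + r * r = 0"
      unfolding r_def by (simp add: power2_eq_square algebra_simps)
    define y where "y = x + r *\<^sub>R e"
    have "star y * y = star x * x + r *\<^sub>R (e * x) + r *\<^sub>R (star x * e) + (r * r) *\<^sub>R e"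
      by (simp add: y_def star_add star_scaleR eD algebra_simps)
    also have "\<dots> = complex_of_real t *\<^sub>C e + (complex_of_real r * k) *\<^sub>C e
        + (complex_of_real r * cnj k) *\<^sub>C e + complex_of_real (r * r) *\<^sub>C e"
      unfolding c' k k' by (simp add: scaleR_scaleC scaleC_scaleC)
    also have "\<dots> = (complex_of_real t + complex_of_real r * k + complex_of_real r * cnj k
        + complex_of_real (r * r)) *\<^sub>C e"
      by (simp add: scaleC_add_left)
    also have "complex_of_real t + complex_of_real r * k + complex_of_real r * cnj k
        + complex_of_real (r * r) = complex_of_real (t + 2 * r * Re k + r * r)"
      by (simp add: complex_eq_iff)
    finally have "y = 0" using root by simp
    then have "x = (- r) *\<^sub>R e" by (simp add: y_def add_eq_0_iff2)
    then have "star x * x = (r * r) *\<^sub>R e" by (simp add: star_minus star_scaleR eD)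
    with c' eD have "t = r * r" by (metis real_vector.scale_cancel_right)
    then show False using \<open>\<not> t \<ge> 0\<close> by simp
  qed
  have "norm e = 1" using norm_projection eD by blast
  then have "(norm x)\<^sup>2 = t" using c' t0 cstar_identity[of x] by simp
  then show ?thesis using c' by simp
qed

text \<open>
  Elements with a minimal right support behave like rank one operators: up to the factor
  \<open>\<parallel>w\<parallel>\<^sup>2\<close>, the product \<open>w w*\<close> is a minimal projection as well, the left support of \<open>w\<close>.
\<close>

lemma minproj_range:
  fixes w :: "'a::cstar_algebra"
  assumes q: "minproj q" and w: "w * q = w" "w \<noteq> 0"
  defines "g \<equiv> inverse ((norm w)\<^sup>2) *\<^sub>R (w * star w)"
  shows "minproj g" "g * w = w" "w * star w = (norm w)\<^sup>2 *\<^sub>R g"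
proof -
  note qD = minprojD[OF q]
  note ww = minproj_star_mult[OF q w(1)]
  have n: "(norm w)\<^sup>2 \<noteq> 0" using w by simp
  have wst: "q * star w = star w" using w qD by (metis star_mult)
  show gw: "g * w = w"
    unfolding g_def using ww w n by (simp add: mult.assoc)
  show wsw: "w * star w = (norm w)\<^sup>2 *\<^sub>R g" unfolding g_def using n by simp
  have "g * g = g"
  proof -
    have "g * (w * star w) = w * star w" using gw by (simp add: mult.assoc[symmetric])
    then show ?thesis unfolding g_def by simp
  qed
  moreover have "star g = g" by (simp add: g_def star_scaleR star_mult star_star)
  moreover have "g \<noteq> 0" using gw w by auto
  moreover have "\<exists>c. g * a * g = c *\<^sub>C g" for a
  proof -
    obtain c where c: "q * (star w * a * w) * q = c *\<^sub>C q" using q by (auto simp: minproj_def)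
    have "w * (star w * a * w) * star w = w * (q * (star w * a * w) * q) * star w"
      using w wst by (simp add: mult.assoc) (metis mult.assoc)
    also have "\<dots> = c *\<^sub>C (w * star w)"
      using c w by (simp add: mult_scaleC_right mult_scaleC_left)
    finally have e: "w * star w * a * (w * star w) = c *\<^sub>C (w * star w)" by (simp add: mult.assoc)
    have "g * a * g = (inverse ((norm w)\<^sup>2) * inverse ((norm w)\<^sup>2)) *\<^sub>R (w * star w * a * (w * star w))"
      by (simp add: g_def)
    also have "\<dots> = (complex_of_real (inverse ((norm w)\<^sup>2)) * c) *\<^sub>C g"
      unfolding e g_def by (simp add: scaleR_scaleC scaleC_scaleC mult.commute mult.left_commute)
    finally show ?thesis by blast
  qed
  ultimately show "minproj g" by (auto simp: minproj_def)
qed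

lemma minproj_source:
  fixes w :: "'a::cstar_algebra"
  assumes q: "minproj q" and w: "q * w = w" "w \<noteq> 0"
  defines "g \<equiv> inverse ((norm w)\<^sup>2) *\<^sub>R (star w * w)"
  shows "minproj g" "w * g = w" "star w * w = (norm w)\<^sup>2 *\<^sub>R g" "w * star w = (norm w)\<^sup>2 *\<^sub>R q"
proof -
  have w': "star w * q = star w" "star w \<noteq> 0"
    using w minprojD[OF q] by (metis star_mult, metis star_star star_zero)
  note r = minproj_range[OF q w']
  show "minproj g" using r(1) by (simp add: g_def star_star)
  then have "star g = g" by (simp add: minproj_def)
  show "w * g = w"
    using r(2) \<open>star g = g\<close> by (simp add: g_def star_star) (metis star_mult star_scaleR star_star)
  show "star w * w = (norm w)\<^sup>2 *\<^sub>R g" using r(3) by (simp add: g_def star_star)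
  show "w * star w = (norm w)\<^sup>2 *\<^sub>R q" using minproj_star_mult[OF q w'(1)] by (simp add: star_star)
qed

text \<open>
  A minimal left ideal \<open>A e\<close> lies in the linear span of the minimal projections: polarization
  writes \<open>a = (a*)* e\<close> as a combination of squares \<open>u* u\<close> with \<open>e u = u\<close>, and each of these is a
  multiple of a minimal projection. The statement has the form of an induction rule, for extending
  linear properties from minimal projections to \<open>A e\<close>.
\<close>

lemma left_ideal_in_span_minproj:
  fixes P :: "'a::cstar_algebra \<Rightarrow> bool"
  assumes add: "\<And>x y. P x \<Longrightarrow> P y \<Longrightarrow> P (x + y)" and scale: "\<And>c x. P x \<Longrightarrow> P (c *\<^sub>C x)"
    and min: "\<And>e. minproj e \<Longrightarrow> P e"
    and e: "minproj e" and a: "a * e = a"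
  shows "P a"
proof -
  note eD = minprojD[OF e]
  have P0: "P 0" using scale[OF min[OF e], of 0] by simp
  have sq: "P (star u * u)" if u: "e * u = u" for u
  proof (cases "u = 0")
    case False
    from minproj_source[OF e u False] min
    show ?thesis using scale[of _ "complex_of_real ((norm u)\<^sup>2)"] by (metis scaleC_of_real)
  qed (use P0 in simp)
  have ea: "e * star a = star a" using a eD by (metis star_mult)
  have inv: "e * (star a + c *\<^sub>C e) = star a + c *\<^sub>C e" for c
    using ea eD by (simp add: algebra_simps mult_scaleC_right)
  have sq': "P (star (star a + c *\<^sub>C e) * (star a + c *\<^sub>C e))" for c by (rule sq[OF inv])
  have "P (4 *\<^sub>C (star (star a) * e))"
    unfolding polarization using sq'[of 1] sq' by (intro add scale) (simp_all add: scaleC_one)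
  then have "P (4 *\<^sub>C a)" using a by (simp add: star_star)
  from scale[OF this, of "1/4"] show ?thesis by (simp add: scaleC_scaleC scaleC_one)
qed

section \<open>Strong orthogonality and orthogonality of ranges\<close>

lemma strong_BJ_orthogonal_if_star_mult_0:
  fixes x y :: "'a::cstar_algebra"
  assumes "star x * y = 0"
  shows "strong_BJ_orthogonal x y"
  unfolding strong_BJ_orthogonal_def
proof
  fix z
  have "star x * (x + y * z) = star x * x"
    using assms by (simp add: distrib_left mult.assoc[symmetric])
  then have "(norm x)\<^sup>2 = norm (star x * (x + y * z))" by (simp add: cstar_identity)
  also have "\<dots> \<le> norm x * norm (x + y * z)" using norm_mult_ineq[of "star x"] by simp
  finally show "norm x \<le> norm (x + y * z)"
    by (cases "x = 0") (auto simp: power2_eq_square)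
qed

text \<open>
  Since \<open>w = w q\<close>, all the products that occur in \<open>\<parallel>w - a y y* w\<parallel>\<^sup>2\<close> are real multiples of the
  same minimal projection, so the norm is the square root of a quadratic polynomial in \<open>a\<close>. Its
  linear coefficient is negative when \<open>y* w \<noteq> 0\<close>, so the norm drops below \<open>\<parallel>w\<parallel>\<close>.
\<close>

lemma not_strong_BJ_orthogonal_minproj:
  fixes w y :: "'a::cstar_algebra"
  assumes q: "minproj q" and w: "w * q = w" and ne: "star y * w \<noteq> 0"
  shows "\<not> strong_BJ_orthogonal w y"
proof -
  note qD = minprojD[OF q]
  define k where "k = star y * w"
  define m where "m = y * k"
  define s where "s = (norm k)\<^sup>2"
  define r where "r = (norm m)\<^sup>2"
  have kq: "k * q = k" and mq: "m * q = m" using w by (simp_all add: k_def m_def mult.assoc)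
  have s: "star k * k = s *\<^sub>R q" "s > 0"
    using minproj_star_mult[OF q kq] ne by (simp_all add: s_def k_def)
  have r: "star m * m = r *\<^sub>R q" using minproj_star_mult[OF q mq] by (simp add: r_def)
  have wm: "star w * m = s *\<^sub>R q"
    using s by (simp add: m_def k_def star_mult star_star mult.assoc)
  then have mw: "star m * w = s *\<^sub>R q" using qD by (metis star_mult star_scaleR star_star)
  have "m \<noteq> 0" using wm s qD by auto
  then have r0: "r > 0" by (simp add: r_def)
  \<comment> \<open>The minimizer of \<open>a \<mapsto> \<parallel>w\<parallel>\<^sup>2 - 2 a s + a\<^sup>2 r\<close>.\<close>
  define a where "a = s / r"
  define d where "d = w - a *\<^sub>R m"
  have dq: "d * q = d" using w mq by (simp add: d_def algebra_simps)
  have "star d * d = star w * w - a *\<^sub>R (star w * m) - a *\<^sub>R (star m * w) + (a * a) *\<^sub>R (star m * m)"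
    by (simp add: d_def star_diff star_scaleR algebra_simps)
  also have "\<dots> = ((norm w)\<^sup>2 - a * s - a * s + a * a * r) *\<^sub>R q"
    unfolding wm mw r minproj_star_mult[OF q w]
    by (simp only: scaleR_diff_left scaleR_add_left scaleR_scaleR)
  finally have "(norm d)\<^sup>2 *\<^sub>R q = ((norm w)\<^sup>2 - a * s - a * s + a * a * r) *\<^sub>R q"
    using minproj_star_mult[OF q dq] by simp
  then have "(norm d)\<^sup>2 = (norm w)\<^sup>2 - a * s - a * s + a * a * r" using qD by simp
  also have "\<dots> = (norm w)\<^sup>2 - s * s / r" using r0 by (simp add: a_def field_simps)
  also have "\<dots> < (norm w)\<^sup>2" using r0 s by simp
  finally have "norm d < norm w" by (simp add: power_less_imp_less_base)
  moreover have "d = w + y * (- (a *\<^sub>R k))" by (simp add: d_def m_def)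
  ultimately show ?thesis unfolding strong_BJ_orthogonal_def by (metis not_less)
qed

definition minproj_faithful :: "'a::cstar_algebra itself \<Rightarrow> bool" where
  "minproj_faithful _ \<longleftrightarrow> (\<forall>k::'a. k \<noteq> 0 \<longrightarrow> (\<exists>q. minproj q \<and> k * q \<noteq> 0))"

text \<open>
  Think of \<open>w\<close> with \<open>v \<bottom> x \<longrightarrow> v \<bottom> w\<close> for all \<open>v\<close> as the elements whose range lies in the
  closure of that of \<open>x\<close>; they include all \<open>x a\<close>. So the right-hand side says that everything in the range of \<open>x\<close> is
  strongly orthogonal to \<open>y\<close>, and if \<open>y* x \<noteq> 0\<close>, then some \<open>x q\<close> with \<open>q\<close> minimal violates it. The
  right-hand side mentions nothing but strong orthogonality, so its truth is invariant under strong
  BJ isomorphisms.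
\<close>

lemma star_mult_eq_0_iff_strong_BJ:
  fixes x y :: "'a::cstar_algebra"
  assumes M: "minproj_faithful TYPE('a)"
  shows "star x * y = 0 \<longleftrightarrow>
    (\<forall>w. (\<forall>v. strong_BJ_orthogonal v x \<longrightarrow> strong_BJ_orthogonal v w) \<longrightarrow> strong_BJ_orthogonal w y)"
    (is "_ \<longleftrightarrow> ?R")
proof
  have wit: "\<exists>a. \<not> strong_BJ_orthogonal (u * a) v" if "star v * u \<noteq> 0" for u v :: 'a
  proof -
    from that M obtain q where q: "minproj q" "star v * u * q \<noteq> 0"
      by (auto simp: minproj_faithful_def)
    then have "\<not> strong_BJ_orthogonal (u * q) v"
      by (intro not_strong_BJ_orthogonal_minproj[OF q(1)]) (auto simp: mult.assoc minprojD)
    then show ?thesis by blast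
  qed
  {
    assume xy: "star x * y = 0"
    show ?R
    proof (intro allI impI)
      fix w
      assume w: "\<forall>v. strong_BJ_orthogonal v x \<longrightarrow> strong_BJ_orthogonal v w"
      have "strong_BJ_orthogonal (y * a) w" for a
      proof -
        have "star (y * a) * x = star a * (star y * x)" by (simp add: star_mult mult.assoc)
        also have "\<dots> = 0" using xy star_mult_eq_0_comm[of x y] by simp
        finally show ?thesis using w strong_BJ_orthogonal_if_star_mult_0 by blast
      qed
      with wit have "star w * y = 0" by blast
      then show "strong_BJ_orthogonal w y" by (rule strong_BJ_orthogonal_if_star_mult_0)
    qed
  next
    assume R: ?R
    have "strong_BJ_orthogonal v (x * a)" if v: "strong_BJ_orthogonal v x" for v a
      using v by (simp add: strong_BJ_orthogonal_def mult.assoc)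
    with R have "strong_BJ_orthogonal (x * a) y" for a by blast
    with wit have "star y * x = 0" by blast
    then show "star x * y = 0" by (simp add: star_mult_eq_0_comm)
  }
qed

section \<open>Minimal projections in algebras of compact operators\<close>

text \<open>
  The type of bounded operators is complete only over a codomain of class \<open>banach\<close>.
\<close>

subclass (in chilbert_space) banach ..

lemma cinner_scaleC_right: "cinner x (c *\<^sub>C y) = cnj c * cinner x (y::'h::chilbert_space)"
  by (metis cinner_scaleC_left cinner_commute complex_cnj_mult)

locale star_rep =
  fixes \<pi> :: "'a::cstar_algebra \<Rightarrow> ('h::chilbert_space \<Rightarrow>\<^sub>L 'h)"
  assumes rep: "star_representation \<pi>" and inj: "inj \<pi>"
begin

lemma add: "\<pi> (x + y) = \<pi> x + \<pi> y"
  using rep by (simp add: star_representation_def)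

lemma mult: "\<pi> (x * y) = \<pi> x o\<^sub>L \<pi> y"
  using rep by (simp add: star_representation_def)

lemma mult_apply: "\<pi> (x * y) u = \<pi> x (\<pi> y u)"
  by (simp add: mult)

lemma scaleC_apply: "\<pi> (c *\<^sub>C x) u = c *\<^sub>C \<pi> x u"
  using rep by (simp add: star_representation_def is_cscaled_def)

lemma apply_scaleC: "\<pi> x (c *\<^sub>C u) = c *\<^sub>C \<pi> x u"
  using rep by (auto simp: star_representation_def bounded_ops_def clinear_def image_subset_iff)

lemma scaleR: "\<pi> (r *\<^sub>R x) = r *\<^sub>R \<pi> x"
  by (rule blinfun_eqI) (simp add: scaleR_scaleC scaleC_apply scaleR_blinfun.rep_eq)

lemma zero [simp]: "\<pi> 0 = 0"
  using add[of 0 0] by simp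

lemma diff: "\<pi> (x - y) = \<pi> x - \<pi> y"
  using add[of "x - y" y] by simp

lemma eq_iff: "\<pi> x = \<pi> y \<longleftrightarrow> x = y"
  using inj by (auto dest: injD)

lemma eq_0_iff [simp]: "\<pi> x = 0 \<longleftrightarrow> x = 0"
  using eq_iff[of x 0] by simp

lemma cadj: "cinner (\<pi> x u) v = cinner u (\<pi> (star x) v)"
  using rep by (simp add: star_representation_def is_adjoint_def)

lemma adj: "inner (\<pi> x u) v = inner u (\<pi> (star x) v)"
  by (simp add: inner_eq_Re_cinner cadj)

lemma inner_star_mult: "inner (\<pi> (star x * x) u) u = (norm (\<pi> x u))\<^sup>2"
  by (simp add: mult_apply adj star_star power2_norm_eq_inner)

lemma norm_star_mult: "norm (\<pi> (star x * x)) = (norm (\<pi> x))\<^sup>2"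
  and norm_rep_star: "norm (\<pi> (star x)) = norm (\<pi> x)"
proof -
  have le: "(norm (\<pi> y))\<^sup>2 \<le> norm (\<pi> (star y * y))" for y
  proof -
    have "norm (\<pi> y u) \<le> sqrt (norm (\<pi> (star y * y))) * norm u" for u
    proof -
      have "(norm (\<pi> y u))\<^sup>2 \<le> norm (\<pi> (star y * y) u) * norm u"
        unfolding inner_star_mult[symmetric] by (rule norm_cauchy_schwarz)
      also have "\<dots> \<le> norm (\<pi> (star y * y)) * norm u * norm u"
        by (intro mult_right_mono norm_blinfun) simp
      finally have "(norm (\<pi> y u))\<^sup>2 \<le> (sqrt (norm (\<pi> (star y * y))) * norm u)\<^sup>2"
        by (simp add: power_mult_distrib) (simp add: power2_eq_square mult.assoc)
      then show ?thesis by (rule power2_le_imp_le) simp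
    qed
    then have "norm (\<pi> y) \<le> sqrt (norm (\<pi> (star y * y)))"
      by (intro norm_blinfun_bound) auto
    then show ?thesis by (metis norm_ge_zero power_mono real_sqrt_pow2)
  qed
  have ge: "norm (\<pi> (star y * y)) \<le> norm (\<pi> (star y)) * norm (\<pi> y)" for y
    unfolding mult by (rule norm_blinfun_compose)
  have le2: "norm (\<pi> y) \<le> norm (\<pi> (star y))" for y
  proof (cases "\<pi> y = 0")
    case False
    have "norm (\<pi> y) * norm (\<pi> y) \<le> norm (\<pi> (star y)) * norm (\<pi> y)"
      using le[of y] ge[of y] by (simp add: power2_eq_square)
    with False show ?thesis by simp
  qed simp
  show st: "norm (\<pi> (star x)) = norm (\<pi> x)" using le2[of x] le2[of "star x"] by (simp add: star_star)
  show "norm (\<pi> (star x * x)) = (norm (\<pi> x))\<^sup>2"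
    using le[of x] ge[of x] st by (simp add: power2_eq_square)
qed

lemma norm_rep_projection:
  assumes "e \<noteq> 0" "star e = e" "e * e = e"
  shows "norm (\<pi> e) = 1"
proof -
  have "norm (\<pi> e) = norm (\<pi> e) * norm (\<pi> e)"
    using norm_star_mult[of e] assms by (simp add: power2_eq_square)
  then show ?thesis using assms by simp
qed

text \<open>
  For a contraction \<open>a\<close>, the operator \<open>1 - a* a\<close> loses at least \<open>\<parallel>a w\<parallel>\<^sup>2\<close> from the squared norm of \<open>w\<close>.
  Summing this along the orbit of \<open>w\<close> gives the rate of convergence in the next lemma.
\<close>

lemma norm_defect:
  assumes "norm (\<pi> a) \<le> 1"
  shows "(norm (\<pi> a w))\<^sup>2 + (norm (w - \<pi> (star a * a) w))\<^sup>2 \<le> (norm w)\<^sup>2"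
proof -
  have "norm (\<pi> (star a) (\<pi> a w)) \<le> norm (\<pi> (star a)) * norm (\<pi> a w)" by (rule norm_blinfun)
  also have "\<dots> \<le> norm (\<pi> a w)" using assms by (simp add: norm_rep_star mult_left_le_one_le)
  finally have "(norm (\<pi> (star a * a) w))\<^sup>2 \<le> (norm (\<pi> a w))\<^sup>2"
    by (simp add: mult_apply power_mono)
  moreover
  have "(norm (w - z))\<^sup>2 = (norm w)\<^sup>2 - 2 * inner z w + (norm z)\<^sup>2" for z
    by (simp add: power2_norm_eq_inner inner_diff_left inner_diff_right inner_commute)
  from this[of "\<pi> (star a * a) w", unfolded inner_star_mult]
  have "(norm (w - \<pi> (star a * a) w))\<^sup>2
      = (norm w)\<^sup>2 - 2 * (norm (\<pi> a w))\<^sup>2 + (norm (\<pi> (star a * a) w))\<^sup>2" .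
  with calculation show ?thesis by simp
qed

text \<open>
  A substitute for an approximate unit. For a contraction \<open>a\<close> the elements \<open>r\<^sub>n = a (1 - a* a)\<^sup>n\<close>
  tend to 0: the norms \<open>\<parallel>a (1 - a* a)\<^sup>n v\<parallel>\<close> decrease in \<open>n\<close> and their squares sum to at most
  \<open>\<parallel>v\<parallel>\<^sup>2\<close>, so \<open>\<parallel>r\<^sub>n\<parallel> \<le> 1 / sqrt n\<close>. On the other hand, \<open>a - r\<^sub>n\<close> is a left multiple of \<open>a\<close>, because each
  step from \<open>r\<^sub>n\<close> to its successor subtracts \<open>r\<^sub>n a* a\<close>.
\<close>

lemma right_approximation: "\<exists>k. (\<lambda>n. \<pi> (k n * a)) \<longlonglongrightarrow> \<pi> a"
proof -
  have contr: "\<exists>k. (\<lambda>n. \<pi> (k n * b)) \<longlonglongrightarrow> \<pi> b" if b: "norm (\<pi> b) \<le> 1" for b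
  proof -
    define S where "S w = w - \<pi> (star b * b) w" for w
    define r where "r n = ((\<lambda>z. z - z * (star b * b)) ^^ n) b" for n
    have r_apply: "\<pi> (r n) v = \<pi> b ((S ^^ n) v)" for n v
    proof (induction n arbitrary: v)
      case (Suc n)
      have "\<pi> (r (Suc n)) v = \<pi> (r n) (S v)"
        by (simp add: r_def S_def diff mult_apply blinfun.diff_left blinfun.diff_right)
      then show ?case by (simp add: Suc.IH funpow_swap1)
    qed (simp add: r_def)
    \<comment> \<open>\<open>b (1 - b* b) = (1 - b b*) b\<close>, and \<open>1 - b b*\<close> is a contraction.\<close>
    have mono: "norm (\<pi> b (S w)) \<le> norm (\<pi> b w)" for w
    proof -
      have "(norm (\<pi> b w - \<pi> (star (star b) * star b) (\<pi> b w)))\<^sup>2 \<le> (norm (\<pi> b w))\<^sup>2"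
        using norm_defect[of "star b" "\<pi> b w"] b
        by (smt (verit) norm_rep_star zero_le_power2)
      then have "norm (\<pi> b w - \<pi> (star (star b) * star b) (\<pi> b w)) \<le> norm (\<pi> b w)"
        by (rule power2_le_imp_le) simp
      then show ?thesis by (simp add: S_def blinfun.diff_right mult_apply star_star)
    qed
    have tel: "real n * (norm (\<pi> b ((S ^^ n) v)))\<^sup>2 + (norm ((S ^^ n) v))\<^sup>2 \<le> (norm v)\<^sup>2" for n v
    proof (induction n)
      case (Suc n)
      let ?w = "(S ^^ n) v"
      have "(norm (\<pi> b (S ?w)))\<^sup>2 \<le> (norm (\<pi> b ?w))\<^sup>2" using mono by (simp add: power_mono)
      then have "real (Suc n) * (norm (\<pi> b (S ?w)))\<^sup>2 \<le> real (Suc n) * (norm (\<pi> b ?w))\<^sup>2"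
        by (intro mult_left_mono) auto
      moreover have "(norm (\<pi> b ?w))\<^sup>2 + (norm (S ?w))\<^sup>2 \<le> (norm ?w)\<^sup>2"
        unfolding S_def by (rule norm_defect[OF b])
      ultimately show ?case using Suc by (simp add: algebra_simps)
    qed simp
    have bound: "norm (\<pi> (r n)) \<le> sqrt (1 / real n)" if n: "n > 0" for n
    proof (rule norm_blinfun_bound)
      fix v
      have "real n * (norm (\<pi> (r n) v))\<^sup>2 \<le> (norm v)\<^sup>2"
        using tel[of n v] unfolding r_apply by (smt (verit) zero_le_power2)
      then have "(norm (\<pi> (r n) v))\<^sup>2 \<le> (sqrt (1 / real n) * norm v)\<^sup>2"
        using n by (simp add: power_mult_distrib field_simps)
      then show "norm (\<pi> (r n) v) \<le> sqrt (1 / real n) * norm v"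
        by (rule power2_le_imp_le) simp
    qed simp
    have "(\<lambda>n. sqrt (1 / real n)) \<longlonglongrightarrow> sqrt 0"
      by (intro tendsto_real_sqrt lim_1_over_n)
    moreover have "\<forall>\<^sub>F n in sequentially. norm (\<pi> (r n)) \<le> sqrt (1 / real n)"
      using bound by (rule eventually_mono[OF eventually_gt_at_top[of 0]])
    ultimately have "(\<lambda>n. \<pi> (r n)) \<longlonglongrightarrow> 0"
      by (intro Lim_null_comparison[where g = "\<lambda>n. sqrt (1 / real n)" and f = "\<lambda>n. \<pi> (r n)"])
        simp_all
    then have "(\<lambda>n. \<pi> b - \<pi> (r n)) \<longlonglongrightarrow> \<pi> b - 0" by (intro tendsto_diff tendsto_const)
    moreover have "\<exists>k. b - r n = k * b" for n
    proof (induction n)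
      case 0
      show ?case by (intro exI[of _ 0]) (simp add: r_def)
    next
      case (Suc n)
      then obtain k where "b - r n = k * b" by blast
      then have "b - r (Suc n) = (k + r n * star b) * b"
        by (simp add: r_def algebra_simps)
      then show ?case by blast
    qed
    then obtain k where "b - r n = k n * b" for n by metis
    then have "\<pi> (k n * b) = \<pi> b - \<pi> (r n)" for n by (metis diff)
    ultimately show ?thesis by (intro exI[of _ k]) simp
  qed
  define t where "t = norm (\<pi> a) + 1"
  have t: "t > 0" by (simp add: t_def add_nonneg_pos)
  have "norm (\<pi> (inverse t *\<^sub>R a)) \<le> 1" using t by (simp add: scaleR field_simps) (simp add: t_def)
  from contr[OF this] obtain k where "(\<lambda>n. \<pi> (k n * (inverse t *\<^sub>R a))) \<longlonglongrightarrow> \<pi> (inverse t *\<^sub>R a)"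
    by blast
  from tendsto_scaleR[OF tendsto_const[of t] this] t
  have "(\<lambda>n. \<pi> (k n * a)) \<longlonglongrightarrow> \<pi> a" by (simp add: scaleR)
  then show ?thesis by blast
qed

end

locale compact_rep = star_rep \<pi>
  for \<pi> :: "'a::cstar_algebra \<Rightarrow> ('h::chilbert_space \<Rightarrow>\<^sub>L 'h)" +
  assumes compact: "range \<pi> \<subseteq> compact_ops" and closed: "closed (range \<pi>)"
begin

lemma uniformly_Cauchy_on_compact:
  fixes f :: "nat \<Rightarrow> 'h \<Rightarrow> 'h"
  assumes K: "compact K" and c: "\<And>v. v \<in> K \<Longrightarrow> Cauchy (\<lambda>n. f n v)"
    and L: "\<And>n u v. norm (f n u - f n v) \<le> norm (u - v)" and e: "e > 0"
  shows "\<exists>N. \<forall>m\<ge>N. \<forall>n\<ge>N. \<forall>v\<in>K. norm (f m v - f n v) < e"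
proof -
  obtain F where F: "F \<subseteq> K" "finite F" "K \<subseteq> (\<Union>x\<in>F. ball x (e/3))"
  proof (rule compactE_image[OF K, of K "\<lambda>x. ball x (e/3)"])
    show "K \<subseteq> (\<Union>x\<in>K. ball x (e/3))" using e by auto
  qed auto
  have "\<exists>N. \<forall>m\<ge>N. \<forall>n\<ge>N. norm (f m x - f n x) < e/3" if "x \<in> K" for x
    using CauchyD[OF c[OF that], of "e/3"] e by simp
  then obtain N where N: "\<And>x m n. x \<in> K \<Longrightarrow> m \<ge> N x \<Longrightarrow> n \<ge> N x \<Longrightarrow> norm (f m x - f n x) < e/3"
    by metis
  define M where "M = Max (insert 0 (N ` F))"
  show ?thesis
  proof (intro exI[of _ M] allI impI ballI)
    fix m n v assume mn: "M \<le> m" "M \<le> n" and "v \<in> K"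
    then obtain x where x: "x \<in> F" "dist x v < e/3" using F by auto
    have "N x \<le> M" unfolding M_def using F x by (intro Max_ge) auto
    then have 1: "norm (f m x - f n x) < e/3" using N x F mn by (meson order_trans subsetD)
    have 2: "norm (f m v - f m x) < e/3" "norm (f n x - f n v) < e/3"
      using L[of m v x] L[of n x v] x by (auto simp: dist_norm norm_minus_commute)
    have "f m v - f n v = (f m v - f m x) + (f m x - f n x) + (f n x - f n v)" by simp
    also have "norm \<dots> \<le> norm (f m v - f m x) + norm (f m x - f n x) + norm (f n x - f n v)"
      by (intro norm_triangle_le add_mono order_refl norm_triangle_ineq)
    finally show "norm (f m v - f n v) < e" using 1 2 by simp
  qed
qed

text \<open>
  The powers of the positive contraction \<open>T = a* a\<close> converge strongly, because the moments
  \<open>\<langle>T\<^sup>k v, v\<rangle>\<close> decrease and \<open>\<parallel>T\<^sup>m v - T\<^sup>n v\<parallel>\<^sup>2\<close> is a combination of them. By equicontinuity the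
  convergence is uniform on the compact closure of the image of the unit ball under \<open>T\<close>, so the
  powers converge in norm, and the limit stays in the closed image of the algebra. It is the
  spectral projection of \<open>T\<close> for the eigenvalue 1; it is not 0 because \<open>T\<^sup>m\<close> has norm 1 for \<open>m\<close> a
  power of 2, by the C*-identity.
\<close>

lemma peripheral_projection_normalized:
  assumes a: "norm (\<pi> a) = 1"
  shows "\<exists>p. p \<noteq> 0 \<and> star p = p \<and> p * p = p \<and> star a * a * p = p"
proof -
  define h where "h = star a * a"
  define T where "T = blinfun_apply (\<pi> h)"
  have hs: "star h = h" by (simp add: h_def star_mult star_star)
  have Ts: "inner (T u) v = inner u (T v)" for u v by (simp add: T_def adj hs)
  have Tn_s: "inner ((T ^^ n) u) v = inner u ((T ^^ n) v)" for n u v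
    by (induction n arbitrary: u v) (auto simp: Ts funpow_swap1)
  have a1: "norm (\<pi> a v) \<le> norm v" "norm (\<pi> (star a) v) \<le> norm v" for v
    using norm_blinfun[of "\<pi> a" v] norm_blinfun[of "\<pi> (star a)" v] a by (simp_all add: norm_rep_star)
  have Tc: "norm (T v) \<le> norm v" for v
    unfolding T_def h_def mult_apply using a1 order_trans by blast
  have T_diff: "(T ^^ n) (u - v) = (T ^^ n) u - (T ^^ n) v" for n u v
    by (induction n) (simp_all add: T_def blinfun.diff_right)
  have Tnc: "norm ((T ^^ n) v) \<le> norm v" for n v
    by (induction n) (auto intro: order_trans[OF Tc])
  have Cau: "Cauchy (\<lambda>n. (T ^^ n) v)" for v
  proof -
    define s where "s k = inner ((T ^^ k) v) v" for k
    have s: "inner ((T ^^ m) v) ((T ^^ n) v) = s (m + n)" for m n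
    proof -
      have "inner ((T ^^ m) v) ((T ^^ n) v) = inner ((T ^^ n) ((T ^^ m) v)) v" by (simp add: Tn_s)
      then show ?thesis unfolding s_def by (metis add.commute comp_apply funpow_add)
    qed
    have dec: "s (Suc k) \<le> s k" "0 \<le> s k" for k
    proof -
      have sq: "inner (T w) w = (norm (\<pi> a w))\<^sup>2" for w
        unfolding T_def h_def by (rule inner_star_mult)
      consider j where "k = j + j" | j where "k = Suc (j + j)"
        by (metis add_Suc_right mult_2 oddE evenE Suc_eq_plus1)
      then have "s (Suc k) \<le> s k \<and> 0 \<le> s k"
      proof cases
        case 1
        let ?w = "(T ^^ j) v"
        have "s (Suc k) = (norm (\<pi> a ?w))\<^sup>2"
          using s[of "Suc j" j] sq[of ?w] 1 by simp
        also have "\<dots> \<le> (norm ?w)\<^sup>2" using a1 by (simp add: power_mono)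
        finally show ?thesis using s[of j j] inner_ge_zero[of ?w] 1 by (simp add: power2_norm_eq_inner)
      next
        case 2
        let ?w = "(T ^^ j) v"
        have "s (Suc k) = (norm (T ?w))\<^sup>2"
          using s[of "Suc j" "Suc j"] 2 by (simp add: power2_norm_eq_inner)
        also have "\<dots> \<le> (norm (\<pi> a ?w))\<^sup>2" using a1 by (simp add: power_mono T_def h_def mult_apply)
        finally show ?thesis using s[of "Suc j" j] sq[of ?w] 2 zero_le_power2[of "norm (\<pi> a ?w)"]
          by simp
      qed
      then show "s (Suc k) \<le> s k" "0 \<le> s k" by auto
    qed
    have "convergent s"
      by (rule decseq_convergent[of s 0]) (use dec in \<open>auto intro: decseq_SucI convergentI\<close>)
    then have Cs: "Cauchy s" by (rule convergent_Cauchy)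
    show ?thesis
    proof (rule CauchyI)
      fix e :: real assume e: "0 < e"
      obtain N where N: "\<And>m n. m \<ge> N \<Longrightarrow> n \<ge> N \<Longrightarrow> norm (s m - s n) < e\<^sup>2/2"
        using CauchyD[OF Cs, of "e\<^sup>2/2"] e by auto
      have "norm ((T ^^ m) v - (T ^^ n) v) < e" if mn: "m \<ge> N" "n \<ge> N" for m n
      proof -
        have "(norm ((T ^^ m) v - (T ^^ n) v))\<^sup>2 = (s (m + m) - s (m + n)) + (s (n + n) - s (m + n))"
          by (simp add: power2_norm_eq_inner inner_diff_left inner_diff_right s add.commute)
        also have "\<dots> < e\<^sup>2/2 + e\<^sup>2/2"
          using N[of "m + m" "m + n"] N[of "n + n" "m + n"] mn
          by (intro add_strict_mono) (simp_all only: real_norm_def abs_less_iff trans_le_add1)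
        also have "\<dots> = e\<^sup>2" by simp
        finally show ?thesis using e by (simp add: power_less_imp_less_base)
      qed
      then show "\<exists>N. \<forall>m\<ge>N. \<forall>n\<ge>N. norm ((T ^^ m) v - (T ^^ n) v) < e" by blast
    qed
  qed
  \<comment> \<open>\<open>t n\<close> is the power of \<open>h\<close> with exponent \<open>n + 1\<close>; the algebra may lack a unit.\<close>
  define t where "t n = ((\<lambda>x. h * x) ^^ n) h" for n
  have t_apply: "\<pi> (t n) v = (T ^^ Suc n) v" for n v
    by (induction n) (simp_all add: t_def T_def mult_apply)
  have "Cauchy (\<lambda>n. \<pi> (t n))"
  proof (rule CauchyI)
    fix e :: real assume e: "0 < e"
    have "\<pi> h \<in> compact_ops" using compact by auto
    then have K: "compact (closure (T ` cball 0 1))" by (simp add: compact_ops_def T_def)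
    have "\<exists>N. \<forall>m\<ge>N. \<forall>n\<ge>N. \<forall>v\<in>closure (T ` cball 0 1). norm ((T ^^ m) v - (T ^^ n) v) < e/2"
      by (rule uniformly_Cauchy_on_compact[OF K Cau])
        (use e Tnc in \<open>simp_all add: T_diff[symmetric]\<close>)
    then obtain N where N: "\<And>m n v. m \<ge> N \<Longrightarrow> n \<ge> N \<Longrightarrow> v \<in> closure (T ` cball 0 1)
        \<Longrightarrow> norm ((T ^^ m) v - (T ^^ n) v) < e/2"
      by blast
    have "norm (\<pi> (t m) - \<pi> (t n)) \<le> e/2" if mn: "m \<ge> N" "n \<ge> N" for m n
    proof (rule norm_blinfun_bound)
      fix v :: 'h
      show "norm ((\<pi> (t m) - \<pi> (t n)) v) \<le> e/2 * norm v"
      proof (cases "v = 0")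
        case False
        define u where "u = inverse (norm v) *\<^sub>R v"
        have u: "norm u = 1" "v = norm v *\<^sub>R u" using False by (simp_all add: u_def)
        have "T u \<in> closure (T ` cball 0 1)" using u closure_subset by fastforce
        from N[OF mn this] have "norm ((\<pi> (t m) - \<pi> (t n)) u) \<le> e/2"
          by (simp add: blinfun.diff_left t_apply funpow_swap1)
        then have "norm v * norm ((\<pi> (t m) - \<pi> (t n)) u) \<le> norm v * (e/2)"
          by (intro mult_left_mono) auto
        moreover have "(\<pi> (t m) - \<pi> (t n)) v = norm v *\<^sub>R (\<pi> (t m) - \<pi> (t n)) u"
          using u(2) by (metis blinfun.scaleR_right)
        ultimately show ?thesis by (simp add: mult.commute)
      qed simp
    qed (use e in simp)
    then show "\<exists>N. \<forall>m\<ge>N. \<forall>n\<ge>N. norm (\<pi> (t m) - \<pi> (t n)) < e"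
      using e by (intro exI[of _ N] allI impI) (rule le_less_trans[of _ "e/2"], simp_all)
  qed
  then obtain P where P: "(\<lambda>n. \<pi> (t n)) \<longlonglongrightarrow> P" by (meson Cauchy_convergent convergent_def)
  then have "P \<in> range \<pi>" using closed_sequentially[OF closed _ P] by auto
  then obtain p where p: "P = \<pi> p" by blast
  have lim: "(\<lambda>n. (T ^^ Suc n) v) \<longlonglongrightarrow> \<pi> p v" for v
    using blinfun.tendsto[OF P tendsto_const[of v]] by (simp only: t_apply p)
  have hp: "h * p = p"
  proof -
    have "\<pi> h (\<pi> p v) = \<pi> p v" for v
    proof (rule LIMSEQ_unique)
      show "(\<lambda>n. T ((T ^^ Suc n) v)) \<longlonglongrightarrow> \<pi> h (\<pi> p v)"
        unfolding T_def by (intro blinfun.tendsto tendsto_const lim[unfolded T_def])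
      show "(\<lambda>n. T ((T ^^ Suc n) v)) \<longlonglongrightarrow> \<pi> p v"
        using LIMSEQ_Suc[OF lim[of v]] by simp
    qed
    then have "\<pi> (h * p) = \<pi> p" by (intro blinfun_eqI) (simp add: mult_apply)
    then show ?thesis by (simp add: eq_iff)
  qed
  have ps: "star p = p"
  proof -
    have "inner (\<pi> p u) v = inner u (\<pi> p v)" for u v
    proof (rule LIMSEQ_unique)
      show "(\<lambda>n. inner ((T ^^ Suc n) u) v) \<longlonglongrightarrow> inner (\<pi> p u) v"
        by (intro tendsto_inner lim tendsto_const)
      show "(\<lambda>n. inner ((T ^^ Suc n) u) v) \<longlonglongrightarrow> inner u (\<pi> p v)"
        unfolding Tn_s by (intro tendsto_inner lim tendsto_const)
    qed
    then have "inner u (\<pi> (star p) v - \<pi> p v) = 0" for u v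
      by (simp add: adj inner_diff_right)
    then have "\<pi> (star p) v = \<pi> p v" for v by (metis inner_eq_zero_iff eq_iff_diff_eq_0)
    then have "\<pi> (star p) = \<pi> p" by (intro blinfun_eqI)
    then show ?thesis by (simp add: eq_iff)
  qed
  have pp: "p * p = p"
  proof -
    have fix1: "(T ^^ n) (\<pi> p v) = \<pi> p v" for n v
      by (induction n) (use hp in \<open>simp_all add: T_def mult_apply[symmetric]\<close>)
    have "\<pi> p (\<pi> p v) = \<pi> p v" for v
      using lim[of "\<pi> p v"] unfolding fix1 by (simp add: LIMSEQ_const_iff)
    then have "\<pi> (p * p) = \<pi> p" by (intro blinfun_eqI) (simp add: mult_apply)
    then show ?thesis by (simp add: eq_iff)
  qed
  have tt: "t m * t n = t (Suc (m + n))" for m n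
    by (induction m) (simp_all add: t_def mult.assoc)
  have ts: "star (t n) = t n" for n
  proof (induction n)
    case (Suc n)
    have "star (t (Suc n)) = star (t n) * h" by (simp add: t_def star_mult hs)
    also have "\<dots> = t n * t 0" by (simp add: Suc) (simp add: t_def)
    finally show ?case by (simp add: tt)
  qed (simp add: t_def hs)
  have nt: "norm (\<pi> (t (2 ^ k - 1))) = 1" for k
  proof (induction k)
    case 0
    show ?case using norm_star_mult[of a] a by (simp add: t_def h_def)
  next
    case (Suc k)
    have "Suc ((m - 1) + (m - 1)) = 2 * m - 1" if "m \<ge> 1" for m :: nat using that by arith
    from this[of "2 ^ k"] have "Suc ((2 ^ k - 1) + (2 ^ k - 1)) = (2::nat) ^ Suc k - 1" by simp
    then show ?case using norm_star_mult[of "t (2 ^ k - 1)"] Suc by (simp add: ts tt)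
  qed
  have "p \<noteq> 0"
  proof
    assume "p = 0"
    then have "(\<lambda>n. \<pi> (t n)) \<longlonglongrightarrow> 0" using P p by simp
    then obtain N where N: "\<And>n. n \<ge> N \<Longrightarrow> norm (\<pi> (t n)) < 1"
      using LIMSEQ_D[of "\<lambda>n. \<pi> (t n)" 0 1] by auto
    have "N < 2 ^ N" by (rule less_exp)
    then have "N \<le> 2 ^ N - 1" by linarith
    with N nt[of N] show False by fastforce
  qed
  with hp ps pp show ?thesis unfolding h_def by blast
qed

lemma peripheral_projection:
  assumes a: "a \<noteq> 0"
  shows "\<exists>p. p \<noteq> 0 \<and> star p = p \<and> p * p = p \<and> star a * a * p = (norm (\<pi> a))\<^sup>2 *\<^sub>R p"
proof -
  define s where "s = norm (\<pi> a)"
  have s: "s > 0" using a by (simp add: s_def)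
  then have "norm (\<pi> (inverse s *\<^sub>R a)) = 1" by (simp add: scaleR) (simp add: s_def)
  from peripheral_projection_normalized[OF this] obtain p
    where p: "p \<noteq> 0" "star p = p" "p * p = p" "star (inverse s *\<^sub>R a) * (inverse s *\<^sub>R a) * p = p" by blast
  have "s * s * (inverse s * inverse s) = 1" using s by (simp add: field_simps)
  then have "s\<^sup>2 *\<^sub>R (star (inverse s *\<^sub>R a) * (inverse s *\<^sub>R a) * p) = star a * a * p"
    by (simp add: star_scaleR power2_eq_square)
  with p show ?thesis unfolding s_def by metis
qed

text \<open>
  Otherwise there is an infinite strictly decreasing sequence of projections below \<open>p\<close>. Unit vectors in
  the ranges of the successive differences are orthonormal and fixed by \<open>p\<close>, which is
  impossible as \<open>p\<close> acts as a compact operator.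
\<close>

lemma exists_atom:
  fixes p :: 'a
  assumes p: "p \<noteq> 0" "star p = p" "p * p = p"
  shows "\<exists>q. q \<noteq> 0 \<and> star q = q \<and> q * q = q \<and> p * q = q \<and>
    (\<forall>q'. q' \<noteq> 0 \<and> star q' = q' \<and> q' * q' = q' \<and> q * q' = q' \<longrightarrow> q' = q)"
proof (rule ccontr)
  assume no: "\<not> ?thesis"
  define ok where "ok q \<longleftrightarrow> q \<noteq> 0 \<and> star q = q \<and> q * q = q \<and> p * q = q" for q
  have step: "\<exists>q'. ok q' \<and> q * q' = q' \<and> q' \<noteq> q" if "ok q" for q
  proof -
    obtain q' where q': "q' \<noteq> 0" "star q' = q'" "q' * q' = q'" "q * q' = q'" "q' \<noteq> q"
      using no \<open>ok q\<close> by (auto simp: ok_def)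
    have "p * q' = q'" using \<open>ok q\<close> q'(4) unfolding ok_def by (metis mult.assoc)
    with q' show ?thesis by (auto simp: ok_def)
  qed
  have "\<exists>f. \<forall>n. ok (f n) \<and> (f n * f (Suc n) = f (Suc n) \<and> f (Suc n) \<noteq> f n)"
    by (rule dependent_nat_choice) (use p step in \<open>auto simp: ok_def\<close>)
  then obtain f where f: "\<And>n. ok (f n)" "\<And>n. f n * f (Suc n) = f (Suc n)" "\<And>n. f (Suc n) \<noteq> f n"
    by blast
  have le: "f m * f n = f n" if "m \<le> n" for m n
    using that
  proof (induction n rule: dec_induct)
    case (step n)
    then show ?case using f(2)[of n] by (metis mult.assoc)
  qed (use f(1) in \<open>simp add: ok_def\<close>)
  have ge: "f n * f m = f n" if "m \<le> n" for m n
    using le[OF that] f(1) by (metis ok_def star_mult)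
  define d where "d n = f n - f (Suc n)" for n
  have dd: "d n * d n = d n" "star (d n) = d n" "d n \<noteq> 0" "p * d n = d n" for n
    using f(1)[of n] f(1)[of "Suc n"] f(3)[of n] le[of n "Suc n"] ge[of n "Suc n"]
    by (auto simp: d_def ok_def algebra_simps star_diff)
  have ortho: "d m * d n = 0" if "m < n" for m n
    using that le[of m n] le[of "Suc m" n] le[of m "Suc n"] le[of "Suc m" "Suc n"]
    by (simp add: d_def algebra_simps)
  have "\<exists>u. norm u = 1 \<and> \<pi> (d n) u = u" for n
  proof -
    have "\<pi> (d n) \<noteq> 0" using dd by simp
    then obtain v where v: "\<pi> (d n) v \<noteq> 0" by (metis blinfun_eqI zero_blinfun.rep_eq)
    define u where "u = inverse (norm (\<pi> (d n) v)) *\<^sub>R \<pi> (d n) v"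
    have "norm u = 1" using v by (simp add: u_def)
    moreover have "\<pi> (d n) u = u"
      using dd(1)[of n] by (simp add: u_def blinfun.scaleR_right mult_apply[symmetric])
    ultimately show ?thesis by blast
  qed
  then obtain u where u: "\<And>n. norm (u n) = 1" "\<And>n. \<pi> (d n) (u n) = u n" by metis
  have in0: "inner (u m) (u n) = 0" if "m < n" for m n
  proof -
    have "inner (u m) (u n) = inner (\<pi> (d m) (u m)) (\<pi> (d n) (u n))" using u by simp
    also have "\<dots> = inner (u m) (\<pi> (d m * d n) (u n))" by (simp add: adj dd mult_apply)
    finally show ?thesis using ortho[OF that] by simp
  qed
  have "\<pi> p \<in> compact_ops" using compact by auto
  then have K: "compact (closure (\<pi> p ` cball 0 1))" by (simp add: compact_ops_def)
  have "\<pi> p (u n) = u n" for n using u(2)[of n] dd(4)[of n] by (metis mult_apply)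
  then have "u n \<in> closure (\<pi> p ` cball 0 1)" for n
    using u(1)[of n] closure_subset by (metis dist_0_norm image_eqI mem_cball order_refl subsetD)
  then obtain l r where "strict_mono r" and lim: "(u \<circ> r) \<longlonglongrightarrow> l"
    using K[unfolded compact_def] by blast
  from lim have "Cauchy (u \<circ> r)" by (intro LIMSEQ_imp_Cauchy)
  then obtain N where N: "norm ((u \<circ> r) N - (u \<circ> r) (Suc N)) < 1"
    using CauchyD[of "u \<circ> r" 1] by (metis le_refl le_SucI zero_less_one)
  have "r N < r (Suc N)" using \<open>strict_mono r\<close> by (simp add: strict_mono_def)
  from in0[OF this] have "(norm ((u \<circ> r) N - (u \<circ> r) (Suc N)))\<^sup>2 = 2"
    using u(1) by (simp add: power2_norm_eq_inner inner_diff_left inner_diff_right inner_commute norm_eq_1)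
  moreover have "(norm ((u \<circ> r) N - (u \<circ> r) (Suc N)))\<^sup>2 \<le> 1\<^sup>2" using N by (intro power_mono) auto
  ultimately show False by simp
qed

text \<open>
  If \<open>b = b q \<noteq> 0\<close>, the spectral projection of \<open>b* b\<close> for its largest eigenvalue lies below the atom
  \<open>q\<close> and hence equals it. So every such square is a multiple of \<open>q\<close>, and by polarization the whole
  corner \<open>q A q\<close> is scalar.
\<close>

lemma atom_minproj:
  fixes q :: 'a
  assumes q: "q \<noteq> 0" "star q = q" "q * q = q"
    and atom: "\<And>q'. q' \<noteq> 0 \<Longrightarrow> star q' = q' \<Longrightarrow> q' * q' = q' \<Longrightarrow> q * q' = q' \<Longrightarrow> q' = q"
  shows "minproj q"
proof -
  have sq: "\<exists>c. star b * b = c *\<^sub>C q" if b: "b * q = b" for b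
  proof (cases "b = 0")
    case True
    then show ?thesis by (intro exI[of _ 0]) simp
  next
    case False
    from peripheral_projection[OF this] obtain p
      where p: "p \<noteq> 0" "star p = p" "p * p = p" "star b * b * p = (norm (\<pi> b))\<^sup>2 *\<^sub>R p" by blast
    define s where "s = (norm (\<pi> b))\<^sup>2"
    have s: "s \<noteq> 0" using False by (simp add: s_def)
    have "q * star b = star b" using b q by (metis star_mult)
    then have "q * (star b * b * p) = star b * b * p" by (simp add: mult.assoc[symmetric])
    then have "s *\<^sub>R (q * p) = s *\<^sub>R p" unfolding p(4) s_def by simp
    then have "q * p = p" using s by simp
    then have "p = q" using atom p by blast
    then have "star b * b = s *\<^sub>R q" using p(4) b by (simp add: mult.assoc s_def)
    then show ?thesis by (metis scaleR_scaleC)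
  qed
  have "\<exists>c. q * a * q = c *\<^sub>C q" for a
  proof -
    define b where "b = q * a * q"
    have qb: "star q * b = b" and bq: "b * q = b" using q by (simp_all add: b_def mult.assoc[symmetric]) (simp add: mult.assoc q)
    have "\<exists>c. star (q + d *\<^sub>C b) * (q + d *\<^sub>C b) = c *\<^sub>C q" for d
      by (rule sq) (simp add: distrib_right q bq mult_scaleC_left)
    then obtain c where c: "\<And>d. star (q + d *\<^sub>C b) * (q + d *\<^sub>C b) = c d *\<^sub>C q" by metis
    from polarization[of q b] have "4 *\<^sub>C b = (c 1 - c (-1) - \<i> * c \<i> + \<i> * c (- \<i>)) *\<^sub>C q"
      unfolding qb c c[of 1, unfolded scaleC_one]
      by (simp add: scaleC_scaleC scaleC_add_left[symmetric])
    then have "(1/4) *\<^sub>C (4 *\<^sub>C b) = ((1/4) * (c 1 - c (-1) - \<i> * c \<i> + \<i> * c (- \<i>))) *\<^sub>C q"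
      by (simp add: scaleC_scaleC)
    then show ?thesis unfolding b_def[symmetric] by (auto simp: scaleC_scaleC scaleC_one)
  qed
  with q show ?thesis by (simp add: minproj_def)
qed

text \<open>
  Below the spectral projection of \<open>a* a\<close> for the eigenvalue \<open>\<parallel>\<pi> a\<parallel>\<^sup>2\<close>, every projection attains
  the norm.
\<close>

lemma norm_attained_on_minproj:
  assumes a: "a \<noteq> 0"
  shows "\<exists>q. minproj q \<and> norm (a * q) = norm (\<pi> a)"
proof -
  from peripheral_projection[OF a] obtain p
    where p: "p \<noteq> 0" "star p = p" "p * p = p" "star a * a * p = (norm (\<pi> a))\<^sup>2 *\<^sub>R p" by blast
  from exists_atom[OF p(1-3)] obtain q where q: "q \<noteq> 0" "star q = q" "q * q = q" "p * q = q"
    and atom: "\<And>q'. q' \<noteq> 0 \<Longrightarrow> star q' = q' \<Longrightarrow> q' * q' = q' \<Longrightarrow> q * q' = q' \<Longrightarrow> q' = q"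
    by blast
  have m: "minproj q" by (rule atom_minproj[OF q(1-3) atom])
  have "star (a * q) * (a * q) = q * (star a * a * p) * q"
    using q by (simp add: star_mult mult.assoc)
  also have "\<dots> = (norm (\<pi> a))\<^sup>2 *\<^sub>R q" unfolding p(4) using q by (simp add: mult.assoc)
  finally have "(norm (a * q))\<^sup>2 *\<^sub>R q = (norm (\<pi> a))\<^sup>2 *\<^sub>R q"
    using minproj_star_mult[OF m, of "a * q"] q by (simp add: mult.assoc)
  then have "norm (a * q) = norm (\<pi> a)" using q by simp
  with m show ?thesis by blast
qed

lemma minproj_faithful: "minproj_faithful TYPE('a)"
  unfolding minproj_faithful_def using norm_attained_on_minproj
  by (metis eq_0_iff norm_eq_zero)

end

lemma compact_cstar_algebra_rep:
  assumes "compact_cstar_algebra TYPE('a::cstar_algebra) TYPE('h::chilbert_space)"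
  shows "\<exists>\<pi> :: 'a \<Rightarrow> ('h \<Rightarrow>\<^sub>L 'h). compact_rep \<pi>"
proof -
  from assms obtain S and \<pi> :: "'a \<Rightarrow> ('h \<Rightarrow>\<^sub>L 'h)" where
    "cstar_subalgebra S" "S \<subseteq> compact_ops" "star_representation \<pi>" "bij_betw \<pi> UNIV S"
    by (auto simp: compact_cstar_algebra_def)
  then have "compact_rep \<pi>"
    by unfold_locales (auto simp: bij_betw_def cstar_subalgebra_def)
  then show ?thesis by blast
qed

section \<open>Linear strong BJ isomorphisms satisfy a ternary identity\<close>

lemma clinearD:
  assumes "clinear f"
  shows "f (x + y) = f x + f y" "f (c *\<^sub>C x) = c *\<^sub>C f x"
  using assms by (auto simp: clinear_def)

lemma clinear_simps:
  assumes f: "clinear f"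
  shows "f 0 = 0" "f (x - y) = f x - f y" "f (r *\<^sub>R x) = r *\<^sub>R f x"
proof -
  show "f 0 = 0" using clinearD(1)[OF f, of 0 0] by simp
  show "f (x - y) = f x - f y" using clinearD(1)[OF f, of "x - y" y] by (simp add: algebra_simps)
  show "f (r *\<^sub>R x) = r *\<^sub>R f x" by (simp add: scaleR_scaleC clinearD[OF f])
qed

lemma clinear_inv:
  assumes f: "clinear f" and b: "bij f"
  shows "clinear (inv f)"
proof -
  have ff: "f (inv f y) = y" for y using b by (simp add: bij_is_surj surj_f_inv_f)
  have "inv f y = x" if "f x = y" for x y using b that by (auto simp: bij_is_inj)
  note inv_eq = this
  show ?thesis
    unfolding clinear_def by (intro conjI allI inv_eq) (simp_all add: clinearD[OF f] ff)
qed

locale linear_strong_BJ_iso =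
  fixes \<Phi> :: "'a::cstar_algebra \<Rightarrow> 'b::cstar_algebra"
  assumes faithfulA: "minproj_faithful TYPE('a)" and faithfulB: "minproj_faithful TYPE('b)"
    and lin: "clinear \<Phi>" and iso: "strong_BJ_isomorphism \<Phi>"
begin

lemmas add = clinearD(1)[OF lin] and scaleC = clinearD(2)[OF lin]
  and zero = clinear_simps(1)[OF lin] and diff = clinear_simps(2)[OF lin]

lemma bij: "bij \<Phi>" and BJ: "strong_BJ_orthogonal (\<Phi> x) (\<Phi> y) \<longleftrightarrow> strong_BJ_orthogonal x y"
  using iso by (auto simp: strong_BJ_isomorphism_def)

lemma surjE: obtains x where "y = \<Phi> x"
  using bij by (metis bij_is_surj surjD)

lemma eq_iff: "\<Phi> x = \<Phi> y \<longleftrightarrow> x = y"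
  using bij by (metis bij_is_inj injD)

lemma eq_0_iff: "\<Phi> x = 0 \<longleftrightarrow> x = 0"
  using eq_iff[of x 0] by (simp add: zero)

lemma inverse: "linear_strong_BJ_iso (inv \<Phi>)"
proof
  show "clinear (inv \<Phi>)" using clinear_inv lin bij .
  have "\<Phi> (inv \<Phi> y) = y" for y using bij by (simp add: bij_is_surj surj_f_inv_f)
  then show "strong_BJ_isomorphism (inv \<Phi>)"
    unfolding strong_BJ_isomorphism_def using BJ bij bij_imp_bij_inv by metis
qed (fact faithfulA faithfulB)+

lemma star_mult_eq_0: "star (\<Phi> x) * \<Phi> y = 0 \<longleftrightarrow> star x * y = 0"
proof -
  have all: "(\<forall>w. P w) \<longleftrightarrow> (\<forall>x. P (\<Phi> x))" for P by (metis surjE)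
  show ?thesis
    unfolding star_mult_eq_0_iff_strong_BJ[OF faithfulA] star_mult_eq_0_iff_strong_BJ[OF faithfulB]
    by (simp add: all BJ)
qed

text \<open>
  A bilinear map that vanishes whenever \<open>x* y = 0\<close> cannot tell on which side of the product a
  projection stands: both \<open>e x, y - e y\<close> and \<open>x - e x, e y\<close> are orthogonal pairs.
\<close>

lemma projection_adjoint:
  assumes e: "star e = e" "e * e = e"
  shows "star (\<Phi> (e * x)) * \<Phi> y = star (\<Phi> x) * \<Phi> (e * y)"
proof -
  have "star (e * x) * (y - e * y) = star x * (e * y - e * e * y)"
    by (simp add: star_mult e(1) algebra_simps)
  then have "star (\<Phi> (e * x)) * \<Phi> (y - e * y) = 0" unfolding star_mult_eq_0 by (simp add: e)
  moreover have "star (x - e * x) * (e * y) = star x * (e * y - e * e * y)"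
    by (simp add: star_mult star_diff e(1) algebra_simps)
  then have "star (\<Phi> (x - e * x)) * \<Phi> (e * y) = 0" unfolding star_mult_eq_0 by (simp add: e)
  ultimately show ?thesis by (simp add: diff star_diff algebra_simps)
qed

text \<open>
  An adjointable map is automatically a right module map; here the map is \<open>\<Phi> x \<mapsto> \<Phi> (e x)\<close>. The
  element \<open>x'\<close> stands for the preimage of \<open>\<Phi> x b\<close>.
\<close>

lemma projection_right_linear:
  assumes e: "star e = e" "e * e = e" and x': "\<Phi> x' = \<Phi> x * b"
  shows "\<Phi> (e * x') = \<Phi> (e * x) * b"
proof (rule eq_if_all_left_mult_eq)
  fix z
  obtain z' where z: "z = \<Phi> z'" by (rule surjE)
  have "star z * \<Phi> (e * x') = star (\<Phi> (e * z')) * \<Phi> x * b"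
    using projection_adjoint[OF e, of z' x'] by (simp add: z x' mult.assoc)
  also have "\<dots> = star z * (\<Phi> (e * x) * b)"
    using projection_adjoint[OF e, of z' x] by (simp add: z mult.assoc[symmetric])
  finally show "star z * \<Phi> (e * x') = star z * (\<Phi> (e * x) * b)" .
qed

text \<open>
  The image of the minimal right ideal \<open>e A\<close> is a right ideal, and all its nonzero elements have the
  same left annihilator, since this is true of \<open>e A\<close>. One of them is of the form \<open>w = \<Phi> e q\<close>
  with \<open>q\<close> minimal, and the left support \<open>g\<close> of \<open>w\<close> then fixes the image of \<open>e A\<close> and belongs to it.
  So \<open>\<Phi> x \<mapsto> \<Phi> (e x)\<close> and left multiplication by \<open>g\<close> are orthogonal projections onto the same right
  ideal.
\<close>

lemma minproj_image:
  assumes e: "minproj e"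
  shows "\<exists>g. minproj g \<and> (\<forall>x. \<Phi> (e * x) = g * \<Phi> x)"
proof -
  note eD = minprojD[OF e]
  have "\<Phi> e \<noteq> 0" using eD by (simp add: eq_0_iff)
  then obtain q where q: "minproj q" "\<Phi> e * q \<noteq> 0"
    using faithfulB by (auto simp: minproj_faithful_def)
  define w where "w = \<Phi> e * q"
  have w: "w * q = w" "w \<noteq> 0" using q minprojD[OF q(1)] by (auto simp: w_def mult.assoc)
  define g where "g = inverse ((norm w)\<^sup>2) *\<^sub>R (w * star w)"
  note g = minproj_range[OF q(1) w, folded g_def]
  note gD = minprojD[OF g(1)]
  obtain w0 where w0: "w = \<Phi> w0" by (rule surjE)
  have "\<Phi> (e * w0) = \<Phi> (e * e) * q"
    by (rule projection_right_linear) (simp_all add: eD w0[symmetric] w_def)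
  then have ew0: "e * w0 = w0" by (simp add: eD w_def[symmetric] w0 eq_iff)
  have ann: "star (\<Phi> z) * \<Phi> a = 0 \<longleftrightarrow> star z * e = 0" if a: "e * a = a" "a \<noteq> 0" for z a
  proof -
    have "star z * a = 0 \<longleftrightarrow> star z * e = 0"
    proof
      assume "star z * a = 0"
      then have "star z * (a * star a) = 0" by (simp add: mult.assoc[symmetric])
      then show "star z * e = 0" using minproj_source(4)[OF e a] a by simp
    next
      assume "star z * e = 0"
      then have "star z * (e * a) = 0" by (simp add: mult.assoc[symmetric])
      then show "star z * a = 0" by (simp add: a)
    qed
    then show ?thesis by (simp add: star_mult_eq_0)
  qed
  have w00: "w0 \<noteq> 0" using w w0 by (auto simp: zero)
  have g_fixes: "g * \<Phi> a = \<Phi> a" if a: "e * a = a" for a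
  proof (cases "a = 0")
    case False
    define z where "z = \<Phi> a - g * \<Phi> a"
    obtain z' where z': "z = \<Phi> z'" by (rule surjE)
    have zg: "star z * g = 0" by (simp add: z_def star_diff star_mult gD algebra_simps)
    then have "star z * (g * w) = 0" by (simp add: mult.assoc[symmetric])
    then have "star z * w = 0" by (simp add: g)
    then have "star z' * e = 0" using ann[OF ew0 w00] by (simp add: z' w0)
    then have "star z * \<Phi> a = 0" using ann[OF a False] by (simp add: z')
    moreover have "star z * (g * \<Phi> a) = 0" using zg by (simp add: mult.assoc[symmetric])
    ultimately have "star z * z = 0" by (simp add: z_def right_diff_distrib)
    then show ?thesis by (simp add: z_def)
  qed (simp add: zero)
  obtain g0 where g0: "g = \<Phi> g0" by (rule surjE)
  have "\<Phi> (e * g0) = \<Phi> (e * w0) * (inverse ((norm w)\<^sup>2) *\<^sub>R star w)"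
    by (rule projection_right_linear) (simp_all add: eD g0[symmetric] w0[symmetric] g_def)
  then have "\<Phi> (e * g0) = \<Phi> g0" by (simp add: ew0 w0[symmetric] g0[symmetric] g_def)
  then have eg0: "e * g0 = g0" by (simp add: eq_iff)
  have "\<Phi> (e * x) = g * \<Phi> x" for x
  proof -
    have "star g0 * (x - e * x) = star (e * g0) * (x - e * x)" by (simp add: eg0)
    also have "\<dots> = star g0 * (e * x - e * e * x)" by (simp add: star_mult eD(2) algebra_simps)
    also have "\<dots> = 0" by (simp add: eD)
    finally have "star g * \<Phi> (x - e * x) = 0" unfolding g0 star_mult_eq_0 .
    then have "g * \<Phi> x = g * \<Phi> (e * x)" by (simp add: gD diff right_diff_distrib)
    also have "\<dots> = \<Phi> (e * x)" by (rule g_fixes) (simp add: mult.assoc[symmetric] eD)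
    finally show ?thesis by simp
  qed
  with g(1) show ?thesis by blast
qed

lemma minproj_preimage:
  assumes "minproj g"
  shows "\<exists>f. minproj f \<and> (\<forall>x. g * \<Phi> x = \<Phi> (f * x))"
proof -
  interpret inv: linear_strong_BJ_iso "inv \<Phi>" by (rule inverse)
  have 1: "inv \<Phi> (\<Phi> x) = x" and 2: "\<Phi> (inv \<Phi> y) = y" for x y
    using bij by (simp_all add: bij_is_inj bij_is_surj surj_f_inv_f)
  from inv.minproj_image[OF assms] show ?thesis by (metis 1 2)
qed

text \<open>
  Minimal projections have this property by \<open>minproj_image\<close>, and it is linear in \<open>a\<close>. Without continuity
  of \<open>\<Phi>\<close> it does not pass to limits, so it is restricted to the span of the minimal projections.
\<close>

lemma left_mult_implemented:
  assumes e: "minproj e" and a: "a * e = a"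
  shows "\<exists>b. \<forall>x. \<Phi> (a * x) = b * \<Phi> x"
proof (rule left_ideal_in_span_minproj[where P = "\<lambda>a. \<exists>b. \<forall>x. \<Phi> (a * x) = b * \<Phi> x", OF _ _ _ e a])
  show "\<exists>b. \<forall>x. \<Phi> ((a + a') * x) = b * \<Phi> x"
    if "\<exists>b. \<forall>x. \<Phi> (a * x) = b * \<Phi> x" "\<exists>b. \<forall>x. \<Phi> (a' * x) = b * \<Phi> x" for a a'
    using that by (metis add distrib_right)
  show "\<exists>b. \<forall>x. \<Phi> ((c *\<^sub>C a) * x) = b * \<Phi> x" if "\<exists>b. \<forall>x. \<Phi> (a * x) = b * \<Phi> x" for c a
    using that by (metis scaleC mult_scaleC_left)
  show "\<exists>b. \<forall>x. \<Phi> (e * x) = b * \<Phi> x" if "minproj e" for e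
    using minproj_image[OF that] by blast
qed

lemma left_mult_adjoint:
  assumes e: "minproj e" and a: "a * e = a"
  shows "star (\<Phi> (a * u)) * \<Phi> y = star (\<Phi> u) * \<Phi> (star a * y)"
proof -
  have "\<forall>u y. star (\<Phi> (a * u)) * \<Phi> y = star (\<Phi> u) * \<Phi> (star a * y)"
  proof (rule left_ideal_in_span_minproj
      [where P = "\<lambda>a. \<forall>u y. star (\<Phi> (a * u)) * \<Phi> y = star (\<Phi> u) * \<Phi> (star a * y)", OF _ _ _ e a])
  qed (auto simp: distrib_right distrib_left star_add add scaleC star_scaleC mult_scaleC_left
      mult_scaleC_right projection_adjoint minprojD)
  then show ?thesis by blast
qed

text \<open>
  Put \<open>x = \<Phi> e\<close> and \<open>y = \<Phi> f\<close>, with right supports \<open>p\<close> and \<open>q\<close>. Strong orthogonality of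
  \<open>x + y\<close> to \<open>y\<close>, applied with \<open>- q\<close>, removes \<open>y\<close> and gives \<open>\<parallel>x + y\<parallel> \<le> \<parallel>x\<parallel>\<close>; likewise for \<open>y\<close>. On
  the other hand the ranges of \<open>x\<close> and \<open>y\<close> are orthogonal, so \<open>\<parallel>(x + y) p\<parallel>\<^sup>2 = \<parallel>x\<parallel>\<^sup>2 + \<parallel>y\<parallel>\<^sup>2 \<parallel>q p\<parallel>\<^sup>2\<close>.
  Both hold only if \<open>q p = 0\<close> and \<open>\<parallel>x\<parallel> \<le> \<parallel>y\<parallel>\<close>.
\<close>

lemma orthogonal_minproj:
  assumes e: "minproj e" and f: "minproj f" and ef: "e * f = 0"
  shows "\<Phi> e * star (\<Phi> f) = 0" and "norm (\<Phi> e) \<le> norm (\<Phi> f)"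
proof -
  note eD = minprojD[OF e] and fD = minprojD[OF f]
  have fe: "f * e = 0" using ef eD fD by (metis star_mult star_zero)
  define x where "x = \<Phi> e"
  define y where "y = \<Phi> f"
  obtain g h where g: "minproj g" "\<And>x. \<Phi> (e * x) = g * \<Phi> x"
    and h: "minproj h" "\<And>x. \<Phi> (f * x) = h * \<Phi> x"
    using minproj_image[OF e] minproj_image[OF f] by blast
  have gx: "g * x = x" "x \<noteq> 0" using g(2)[of e] eD by (simp_all add: x_def eq_0_iff)
  have hy: "h * y = y" "y \<noteq> 0" using h(2)[of f] fD by (simp_all add: y_def eq_0_iff)
  define p where "p = inverse ((norm x)\<^sup>2) *\<^sub>R (star x * x)"
  define q where "q = inverse ((norm y)\<^sup>2) *\<^sub>R (star y * y)"
  note p = minproj_source[OF g(1) gx, folded p_def]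
  note q = minproj_source[OF h(1) hy, folded q_def]
  note pD = minprojD[OF p(1)] and qD = minprojD[OF q(1)]
  have sum: "norm (e + f) = 1"
  proof (rule norm_projection)
    have "e * (e + f) = e" by (simp add: distrib_left eD ef)
    then show "e + f \<noteq> 0" using eD by auto
  qed (simp_all add: star_add algebra_simps eD fD ef fe)
  have BJ1: "strong_BJ_orthogonal (e + f) f" and BJ2: "strong_BJ_orthogonal (e + f) e"
    unfolding strong_BJ_orthogonal_def sum
  proof (safe)
    fix z
    have "e * (e + f + f * z) = e" by (simp add: distrib_left eD ef mult.assoc[symmetric])
    then show "1 \<le> norm (e + f + f * z)"
      using norm_mult_ineq[of e "e + f + f * z"] norm_projection[OF eD] by simp
    have "f * (e + f + e * z) = f" by (simp add: distrib_left fD fe mult.assoc[symmetric])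
    then show "1 \<le> norm (e + f + e * z)"
      using norm_mult_ineq[of f "e + f + e * z"] norm_projection[OF fD] by simp
  qed
  have "strong_BJ_orthogonal (x + y) y" "strong_BJ_orthogonal (x + y) x"
    using BJ1 BJ2 by (simp_all add: x_def y_def add[symmetric] BJ)
  then have "norm (x + y) \<le> norm (x + y + y * (- q))" "norm (x + y) \<le> norm (x + y + x * (- p))"
    unfolding strong_BJ_orthogonal_def by blast+
  then have le: "norm (x + y) \<le> norm x" "norm (x + y) \<le> norm y" using p(2) q(2) by simp_all
  have xy: "star x * y = 0" unfolding x_def y_def star_mult_eq_0 by (simp add: eD ef)
  then have yx: "star y * x = 0" by (simp add: star_mult_eq_0_comm)
  define k where "k = (x + y) * p"
  have "star k * k = p * (star x * x + star y * y) * p"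
    by (simp add: k_def star_mult star_add pD(2) algebra_simps xy yx)
      (metis (no_types, lifting) xy yx mult.assoc mult_zero_left mult_zero_right add_0)
  also have "\<dots> = (norm x)\<^sup>2 *\<^sub>R p + (norm y)\<^sup>2 *\<^sub>R (star (q * p) * (q * p))"
    unfolding p(3) q(3) by (simp add: algebra_simps star_mult pD qD)
       (metis mult.assoc pD(3) qD(3))
  also have "star (q * p) * (q * p) = (norm (q * p))\<^sup>2 *\<^sub>R p"
    by (rule minproj_star_mult[OF p(1)]) (simp add: mult.assoc pD)
  finally have "(norm k)\<^sup>2 *\<^sub>R p = ((norm x)\<^sup>2 + (norm y)\<^sup>2 * (norm (q * p))\<^sup>2) *\<^sub>R p"
    using minproj_star_mult[OF p(1), of k] by (simp add: k_def mult.assoc pD scaleR_add_left)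
  then have k: "(norm k)\<^sup>2 = (norm x)\<^sup>2 + (norm y)\<^sup>2 * (norm (q * p))\<^sup>2" using pD by simp
  have "norm k \<le> norm (x + y)"
    using norm_mult_ineq[of "x + y" p] norm_projection[OF pD] by (simp add: k_def)
  then have kx: "norm k \<le> norm x" and ky: "norm k \<le> norm y" using le by linarith+
  have "(norm x)\<^sup>2 + (norm y)\<^sup>2 * (norm (q * p))\<^sup>2 \<le> (norm x)\<^sup>2"
    using power_mono[OF kx, of 2] k by simp
  then have "(norm y)\<^sup>2 * (norm (q * p))\<^sup>2 \<le> 0" by simp
  moreover have "(norm y)\<^sup>2 * (norm (q * p))\<^sup>2 \<ge> 0" by simp
  ultimately have "(norm y)\<^sup>2 * (norm (q * p))\<^sup>2 = 0" by linarith
  then have qp: "q * p = 0" using hy by simp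
  then have pq: "p * q = 0" using pD qD by (metis star_mult star_zero)
  have "x * star y = (x * p) * star (y * q)" by (simp add: p q)
  also have "\<dots> = x * (p * q) * star y" by (simp add: star_mult qD mult.assoc)
  finally show "\<Phi> e * star (\<Phi> f) = 0" by (simp add: pq x_def y_def)
  have "(norm x)\<^sup>2 \<le> (norm y)\<^sup>2" using power_mono[OF ky, of 2] k qp by simp
  then show "norm (\<Phi> e) \<le> norm (\<Phi> f)" unfolding x_def y_def by (rule power2_le_imp_le) simp
qed

text \<open>
  Orthogonality of supports is preserved as well. After multiplication by a minimal projection on the
  left, \<open>z\<close> has a minimal right support \<open>q\<close> orthogonal to \<open>e\<close>, and the previous lemma applies to
  \<open>q\<close> and \<open>e\<close>.
\<close>

lemma mult_star_eq_0:
  assumes e: "minproj e" and ze: "z * e = 0"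
  shows "\<Phi> z * star (\<Phi> e) = 0"
proof (rule ccontr)
  assume ne: "\<not> ?thesis"
  have "star (\<Phi> z * star (\<Phi> e)) \<noteq> 0" using ne by (metis star_star star_zero)
  then obtain g where g: "minproj g" "star (\<Phi> z * star (\<Phi> e)) * g \<noteq> 0"
    using faithfulB by (auto simp: minproj_faithful_def)
  obtain f where f: "minproj f" "\<And>x. g * \<Phi> x = \<Phi> (f * x)" using minproj_preimage[OF g(1)] by blast
  define w where "w = f * z"
  have "star (\<Phi> z * star (\<Phi> e)) * g = star (g * \<Phi> z * star (\<Phi> e))"
    by (simp add: star_mult star_star mult.assoc minprojD[OF g(1)])
  also have "\<dots> = star (\<Phi> w * star (\<Phi> e))" by (simp add: f w_def)
  finally have ne': "\<Phi> w * star (\<Phi> e) \<noteq> 0" using g by auto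
  then have w: "f * w = w" "w \<noteq> 0"
    by (auto simp: zero w_def mult.assoc[symmetric] minprojD[OF f(1)])
  define q where "q = inverse ((norm w)\<^sup>2) *\<^sub>R (star w * w)"
  note q = minproj_source[OF f(1) w, folded q_def]
  have "q * e = 0" by (simp add: q_def w_def mult.assoc ze)
  from orthogonal_minproj(1)[OF q(1) e this] have qe: "\<Phi> q * star (\<Phi> e) = 0" .
  obtain b where "\<And>x. \<Phi> (w * x) = b * \<Phi> x" using left_mult_implemented[OF q(1,2)] by blast
  from this[of q] have "\<Phi> w = b * \<Phi> q" by (simp add: q)
  then show False using ne' qe by (simp add: mult.assoc)
qed

text \<open>
  Right multiplication of \<open>x\<close> by \<open>e\<close> does not change \<open>\<Phi> x (\<Phi> e)*\<close>, by the previous lemma. This reduces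
  the claim to \<open>x \<in> A e\<close>, where \<open>x\<close> acts on the left through an element of the target.
\<close>

lemma ternary_minproj:
  assumes e: "minproj e"
  shows "\<Phi> x * star (\<Phi> e) * \<Phi> y = (norm (\<Phi> e))\<^sup>2 *\<^sub>R \<Phi> (x * e * y)"
proof -
  note eD = minprojD[OF e]
  obtain g where g: "minproj g" "\<And>x. \<Phi> (e * x) = g * \<Phi> x" using minproj_image[OF e] by blast
  have "g * \<Phi> e = \<Phi> e" "\<Phi> e \<noteq> 0" using g(2)[of e] eD by (simp_all add: eq_0_iff)
  note s = minproj_source(4)[OF g(1) this]
  have "(x - x * e) * e = 0" by (simp add: left_diff_distrib mult.assoc eD)
  from mult_star_eq_0[OF e this] have 1: "\<Phi> x * star (\<Phi> e) = \<Phi> (x * e) * star (\<Phi> e)"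
    by (simp add: diff left_diff_distrib)
  obtain b where b: "\<And>u. \<Phi> (x * e * u) = b * \<Phi> u"
    using left_mult_implemented[OF e, of "x * e"] eD by (auto simp: mult.assoc)
  have "\<Phi> (x * e) = b * \<Phi> e" using b[of e] by (simp add: mult.assoc eD)
  then have "\<Phi> x * star (\<Phi> e) * \<Phi> y = b * ((norm (\<Phi> e))\<^sup>2 *\<^sub>R g) * \<Phi> y"
    using 1 s by (simp add: mult.assoc)
  also have "\<dots> = (norm (\<Phi> e))\<^sup>2 *\<^sub>R (b * \<Phi> (e * y))" by (simp add: g mult.assoc)
  also have "b * \<Phi> (e * y) = \<Phi> (x * e * (e * y))" by (simp add: b)
  also have "x * e * (e * y) = x * e * y" by (metis eD(3) mult.assoc)
  finally show ?thesis .
qed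

text \<open>
  For \<open>e f = 0\<close> this is part of the analysis of orthogonal pairs. Otherwise \<open>\<Phi> f (\<Phi> e)*\<close> and its adjoint
  \<open>\<Phi> e (\<Phi> f)*\<close> implement the multiplications by \<open>f e\<close> and \<open>e f\<close>, with factors \<open>\<parallel>\<Phi> e\<parallel>\<^sup>2\<close> and
  \<open>\<parallel>\<Phi> f\<parallel>\<^sup>2\<close>, and comparing adjoints makes the factors equal.
\<close>

lemma norm_minproj_const:
  assumes e: "minproj e" and f: "minproj f"
  shows "norm (\<Phi> e) = norm (\<Phi> f)"
proof (cases "e * f = 0")
  case True
  then have "f * e = 0" using minprojD[OF e] minprojD[OF f] by (metis star_mult star_zero)
  with orthogonal_minproj(2)[OF e f True] orthogonal_minproj(2)[OF f e] show ?thesis by simp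
next
  case False
  note eD = minprojD[OF e] and fD = minprojD[OF f]
  have fe: "f * e \<noteq> 0" using False eD fD by (metis star_mult star_zero)
  define K where "K = \<Phi> (f * e * f)"
  have "f * e * f = star (e * f) * (e * f)"
    by (simp add: star_mult eD fD mult.assoc) (metis eD(3) mult.assoc)
  then have "K \<noteq> 0" using False by (simp add: K_def eq_0_iff)
  have "(norm (\<Phi> e))\<^sup>2 *\<^sub>R (star K * K) = (norm (\<Phi> f))\<^sup>2 *\<^sub>R (star K * K)"
  proof -
    define u where "u = f * e * f"
    have "(norm (\<Phi> e))\<^sup>2 *\<^sub>R (star (\<Phi> u) * \<Phi> (f * e * f))
      = star (\<Phi> u) * (\<Phi> f * star (\<Phi> e) * \<Phi> f)" by (simp add: ternary_minproj[OF e])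
    also have "\<dots> = star (\<Phi> e * star (\<Phi> f) * \<Phi> u) * \<Phi> f"
      by (simp add: star_mult star_star mult.assoc)
    also have "\<dots> = (norm (\<Phi> f))\<^sup>2 *\<^sub>R (star (\<Phi> (e * (f * u))) * \<Phi> f)"
      unfolding ternary_minproj[OF f] by (simp add: star_scaleR mult.assoc)
    also have "star (\<Phi> (e * (f * u))) * \<Phi> f = star (\<Phi> u) * \<Phi> (f * (e * f))"
      by (simp add: projection_adjoint eD fD)
    finally show ?thesis by (simp add: K_def u_def mult.assoc)
  qed
  then show ?thesis using \<open>K \<noteq> 0\<close> by simp
qed

lemma eq_0_if_minproj_mult:
  assumes "\<And>g. minproj g \<Longrightarrow> g * k = 0"
  shows "k = (0::'b)"
proof (rule ccontr)
  assume "k \<noteq> 0"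
  then have "star k \<noteq> 0" by (metis star_star star_zero)
  then obtain g where g: "minproj g" "star k * g \<noteq> 0"
    using faithfulB by (auto simp: minproj_faithful_def)
  then have "star (g * k) \<noteq> 0" by (simp add: star_mult minprojD)
  then show False using assms[OF g(1)] by simp
qed

text \<open>
  For an algebra without minimal projections, which is then the zero algebra, any \<open>c > 0\<close> will do;
  otherwise \<open>c\<close> is the common value of \<open>\<parallel>\<Phi> e\<parallel>\<^sup>2\<close>.
\<close>

lemma ternary:
  "\<exists>c>0. \<forall>x y z. \<Phi> z * star (\<Phi> x) * \<Phi> y = c *\<^sub>R \<Phi> (z * star x * y)"
proof -
  obtain c where c: "c > 0" "\<And>e. minproj e \<Longrightarrow> (norm (\<Phi> e))\<^sup>2 = c"
  proof (cases "\<exists>e::'a. minproj e")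
    case True
    then obtain e :: 'a where e: "minproj e" by blast
    show ?thesis
      by (rule that[of "(norm (\<Phi> e))\<^sup>2"])
        (use minprojD[OF e] norm_minproj_const[OF _ e] in \<open>simp_all add: eq_0_iff\<close>)
  next
    case False
    then show ?thesis by (intro that[of 1]) auto
  qed
  \<comment> \<open>The projection moves from the middle to the left by taking adjoints.\<close>
  have min: "\<Phi> e * star (\<Phi> x) * \<Phi> y = c *\<^sub>R \<Phi> (e * star x * y)" if e: "minproj e" for e x y
  proof (rule eq_if_all_left_mult_eq)
    fix u'
    note eD = minprojD[OF e]
    obtain u where u: "u' = \<Phi> u" by (rule surjE)
    have "star u' * (\<Phi> e * star (\<Phi> x) * \<Phi> y) = star (\<Phi> x * star (\<Phi> e) * \<Phi> u) * \<Phi> y"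
      by (simp add: u star_mult star_star mult.assoc)
    also have "\<dots> = c *\<^sub>R (star (\<Phi> (x * e * u)) * \<Phi> y)"
      by (simp add: ternary_minproj[OF e] c(2)[OF e] star_scaleR)
    also have "star (\<Phi> (x * e * u)) * \<Phi> y = star (\<Phi> u) * \<Phi> (star (x * e) * y)"
      by (rule left_mult_adjoint[OF e]) (simp add: mult.assoc eD)
    finally show "star u' * (\<Phi> e * star (\<Phi> x) * \<Phi> y) = star u' * (c *\<^sub>R \<Phi> (e * star x * y))"
      by (simp add: u star_mult eD)
  qed
  \<comment> \<open>A minimal projection applied on the left turns \<open>z\<close> into an element \<open>w\<close> with minimal right
     support \<open>q\<close>, for which \<open>\<Phi> w = b \<Phi> q\<close>.\<close>
  have "\<Phi> z * star (\<Phi> x) * \<Phi> y - c *\<^sub>R \<Phi> (z * star x * y) = 0" for x y z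
  proof (rule eq_0_if_minproj_mult)
    fix g :: 'b
    assume "minproj g"
    then obtain f where f: "minproj f" "\<And>x. g * \<Phi> x = \<Phi> (f * x)" using minproj_preimage by blast
    define w where "w = f * z"
    have "g * (\<Phi> z * star (\<Phi> x) * \<Phi> y - c *\<^sub>R \<Phi> (z * star x * y))
      = (g * \<Phi> z) * star (\<Phi> x) * \<Phi> y - c *\<^sub>R (g * \<Phi> (z * star x * y))"
      by (simp add: right_diff_distrib mult.assoc)
    also have "\<dots> = \<Phi> w * star (\<Phi> x) * \<Phi> y - c *\<^sub>R \<Phi> (w * star x * y)"
      by (simp add: f w_def mult.assoc)
    also have "\<dots> = 0"
    proof (cases "w = 0")
      case False
      have fw: "f * w = w" by (simp add: w_def mult.assoc[symmetric] minprojD[OF f(1)])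
      define q where "q = inverse ((norm w)\<^sup>2) *\<^sub>R (star w * w)"
      note q = minproj_source[OF f(1) fw False, folded q_def]
      obtain b where b: "\<And>x. \<Phi> (w * x) = b * \<Phi> x" using left_mult_implemented[OF q(1,2)] by blast
      have "\<Phi> w = b * \<Phi> q" using b[of q] by (simp add: q)
      then have "\<Phi> w * star (\<Phi> x) * \<Phi> y = b * (\<Phi> q * star (\<Phi> x) * \<Phi> y)" by (simp add: mult.assoc)
      also have "\<dots> = c *\<^sub>R \<Phi> (w * (q * star x * y))" by (simp add: min[OF q(1)] b)
      also have "w * (q * star x * y) = w * star x * y" by (simp add: mult.assoc[symmetric] q)
      finally show ?thesis by simp
    qed (simp add: zero)
    finally show "g * (\<Phi> z * star (\<Phi> x) * \<Phi> y - c *\<^sub>R \<Phi> (z * star x * y)) = 0" .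
  qed
  with c(1) show ?thesis by auto
qed

end

section \<open>The *-isomorphism underlying a ternary isomorphism\<close>

locale ternary_isomorphism = A: compact_rep \<pi> + B: compact_rep \<rho>
  for \<pi> :: "'a::cstar_algebra \<Rightarrow> ('g::chilbert_space \<Rightarrow>\<^sub>L 'g)"
    and \<rho> :: "'b::cstar_algebra \<Rightarrow> ('h::chilbert_space \<Rightarrow>\<^sub>L 'h)" +
  fixes \<Phi> :: "'a \<Rightarrow> 'b" and c :: real
  assumes lin: "clinear \<Phi>" and bij: "bij \<Phi>" and c: "c > 0"
    and ternary: "\<Phi> z * star (\<Phi> x) * \<Phi> y = c *\<^sub>R \<Phi> (z * star x * y)"
begin

lemmas add = clinearD(1)[OF lin] and scaleC = clinearD(2)[OF lin]
  and zero = clinear_simps(1)[OF lin] and diff = clinear_simps(2)[OF lin]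
  and scaleR = clinear_simps(3)[OF lin]

lemma surjE: obtains x where "y = \<Phi> x"
  using bij by (metis bij_is_surj surjD)

lemma eq_iff: "\<Phi> x = \<Phi> y \<longleftrightarrow> x = y"
  using bij by (metis bij_is_inj injD)

lemma inverse: "ternary_isomorphism \<rho> \<pi> (inv \<Phi>) (inverse c)"
proof
  show "clinear (inv \<Phi>)" "bij (inv \<Phi>)" using clinear_inv lin bij bij_imp_bij_inv by blast+
  show "inverse c > 0" using c by simp
  fix x y z
  obtain x' y' z' where xyz: "x = \<Phi> x'" "y = \<Phi> y'" "z = \<Phi> z'" by (metis surjE)
  have inv: "inv \<Phi> (\<Phi> u) = u" for u using bij by (simp add: bij_is_inj)
  have "z * star x * y = \<Phi> (c *\<^sub>R (z' * star x' * y'))" by (simp add: xyz ternary scaleR)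
  then show "inv \<Phi> z * star (inv \<Phi> x) * inv \<Phi> y = inverse c *\<^sub>R inv \<Phi> (z * star x * y)"
    using c by (simp add: xyz inv)
qed

text \<open>
  Pick \<open>q\<close> such that \<open>w = x q\<close> attains the norm. Then \<open>\<Phi> w = \<Phi> x p\<close> for a projection \<open>p\<close>, so it is
  enough to know \<open>\<parallel>\<Phi> w\<parallel>\<close>; and \<open>w w* w = \<parallel>w\<parallel>\<^sup>2 w\<close> translates into the same equation for \<open>\<Phi> w\<close> with the
  additional factor \<open>c\<close>.
\<close>

lemma norm_ge: "sqrt c * norm (\<pi> x) \<le> norm (\<rho> (\<Phi> x))"
proof (cases "x = 0")
  case False
  then obtain q where q: "minproj q" "norm (x * q) = norm (\<pi> x)"
    using A.norm_attained_on_minproj by blast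
  note qD = minprojD[OF q(1)]
  define w where "w = x * q"
  have wq: "w * q = w" by (simp add: w_def mult.assoc qD)
  define p where "p = inverse c *\<^sub>R (star (\<Phi> q) * \<Phi> q)"
  have "p * p = p"
    using ternary[of q q q] c by (simp add: p_def qD mult.assoc)
  moreover have "star p = p" by (simp add: p_def star_scaleR star_mult star_star)
  moreover have "p \<noteq> 0" using eq_iff[of q 0] qD c by (simp add: p_def zero)
  ultimately have p: "norm (\<rho> p) = 1" using B.norm_rep_projection by blast
  have "\<Phi> w = \<Phi> x * p" using ternary[of x q q] c by (simp add: p_def w_def qD mult.assoc)
  then have 1: "norm (\<rho> (\<Phi> w)) \<le> norm (\<rho> (\<Phi> x))"
    using norm_blinfun_compose[of "\<rho> (\<Phi> x)" "\<rho> p"] by (simp add: B.mult p)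
  define Y where "Y = \<Phi> w"
  define t where "t = c * (norm w)\<^sup>2"
  have "w * star w * w = (norm w)\<^sup>2 *\<^sub>R w"
    using minproj_star_mult[OF q(1) wq] wq by (simp add: mult.assoc)
  then have "Y * (star Y * Y) = t *\<^sub>R Y"
    using ternary[of w w w] by (simp add: Y_def t_def scaleR mult.assoc)
  then have "(star Y * Y) * (star Y * Y) = t *\<^sub>R (star Y * Y)" by (simp add: mult.assoc)
  moreover have "star (star Y * Y) = star Y * Y" by (simp add: star_mult star_star)
  ultimately have "(norm (\<rho> (star Y * Y)))\<^sup>2 = norm (t *\<^sub>R \<rho> (star Y * Y))"
    using B.norm_star_mult[of "star Y * Y"] by (simp add: B.scaleR)
  moreover have "t \<ge> 0" using c by (simp add: t_def)
  moreover have "w \<noteq> 0" using q(2) False by (auto simp: w_def)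
  then have "Y \<noteq> 0" using eq_iff[of w 0] by (simp add: Y_def zero)
  ultimately have "norm (\<rho> (star Y * Y)) = t" by (simp add: power2_eq_square)
  then have "norm (\<rho> Y) = sqrt c * norm w"
    using c by (simp add: B.norm_star_mult t_def real_sqrt_mult flip: real_sqrt_unique)
      (metis norm_ge_zero real_sqrt_abs real_sqrt_mult abs_norm_cancel)
  with 1 q(2) show ?thesis by (simp add: Y_def w_def)
qed (simp add: zero)

text \<open>
  The inverse of \<open>\<Phi>\<close> is ternary with constant \<open>1 / c\<close>, so the lower bound holds for it too.
\<close>

lemma norm_eq: "norm (\<rho> (\<Phi> x)) = sqrt c * norm (\<pi> x)"
proof -
  interpret inv: ternary_isomorphism \<rho> \<pi> "inv \<Phi>" "inverse c" by (rule inverse)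
  have "inv \<Phi> (\<Phi> x) = x" using bij by (simp add: bij_is_inj)
  then have "inverse (sqrt c) * norm (\<rho> (\<Phi> x)) \<le> norm (\<pi> x)"
    using inv.norm_ge[of "\<Phi> x"] by (simp add: real_sqrt_inverse)
  then have "norm (\<rho> (\<Phi> x)) \<le> sqrt c * norm (\<pi> x)" using c by (simp add: field_simps)
  with norm_ge[of x] show ?thesis by simp
qed

text \<open>
  If \<open>a\<close> is a product \<open>u* v\<close>, the ternary identity exhibits \<open>b = (\<Phi> u)* \<Phi> v / c\<close>. In general \<open>a\<close> is a limit of
  products \<open>k\<^sub>n a\<close>, and since \<open>\<Phi>\<close> is a multiple of an isometry the corresponding \<open>b\<^sub>n\<close> form a Cauchy
  sequence.
\<close>

lemma right_mult_implemented: "\<exists>b. \<forall>x. \<Phi> (x * a) = \<Phi> x * b"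
proof -
  obtain k where k: "(\<lambda>n. \<pi> (k n * a)) \<longlonglongrightarrow> \<pi> a" using A.right_approximation by blast
  define b where "b n = inverse c *\<^sub>R (star (\<Phi> (star (k n))) * \<Phi> a)" for n
  have b: "\<Phi> (x * (k n * a)) = \<Phi> x * b n" for n x
    using ternary[of x "star (k n)" a] c by (simp add: b_def star_star mult.assoc)
  have le: "norm (\<rho> (b m) - \<rho> (b n)) \<le> norm (\<pi> (k m * a) - \<pi> (k n * a))" for m n
  proof (cases "b m = b n")
    case False
    define y where "y = b m - b n"
    define d where "d = k m * a - k n * a"
    obtain x where x: "star y = \<Phi> x" by (rule surjE)
    have "\<Phi> (x * d) = \<Phi> x * y" by (simp add: d_def y_def right_diff_distrib diff b)
    then have "star y * y = \<Phi> (x * d)" by (simp only: x)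
    then have "(norm (\<rho> y))\<^sup>2 = sqrt c * norm (\<pi> (x * d))"
      by (simp add: B.norm_star_mult[symmetric] norm_eq)
    also have "\<dots> \<le> sqrt c * (norm (\<pi> x) * norm (\<pi> d))"
      unfolding A.mult using c by (intro mult_left_mono norm_blinfun_compose) simp
    also have "\<dots> = norm (\<rho> (star y)) * norm (\<pi> d)" by (simp add: x norm_eq)
    finally have "norm (\<rho> y) * norm (\<rho> y) \<le> norm (\<rho> y) * norm (\<pi> d)"
      by (simp add: B.norm_rep_star power2_eq_square)
    moreover have "norm (\<rho> y) > 0" using False by (simp add: y_def)
    ultimately have "norm (\<rho> y) \<le> norm (\<pi> d)" by simp
    then show ?thesis by (simp add: y_def d_def A.diff B.diff)
  qed simp
  have "Cauchy (\<lambda>n. \<rho> (b n))"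
  proof (rule CauchyI)
    fix e :: real assume "0 < e"
    from CauchyD[OF LIMSEQ_imp_Cauchy[OF k] this] le
    show "\<exists>N. \<forall>m\<ge>N. \<forall>n\<ge>N. norm (\<rho> (b m) - \<rho> (b n)) < e" by (meson le_less_trans)
  qed
  then obtain R where R: "(\<lambda>n. \<rho> (b n)) \<longlonglongrightarrow> R" by (meson Cauchy_convergent convergent_def)
  then have "R \<in> range \<rho>" using closed_sequentially[OF B.closed _ R] by auto
  then obtain r where r: "R = \<rho> r" by blast
  have "\<Phi> (x * a) = \<Phi> x * r" for x
  proof -
    have "(\<lambda>n. \<rho> (\<Phi> x) o\<^sub>L \<rho> (b n)) \<longlonglongrightarrow> (\<rho> (\<Phi> x) o\<^sub>L R)"
      by (intro bounded_bilinear.tendsto[OF bounded_bilinear_blinfun_compose] tendsto_const R)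
    then have 1: "(\<lambda>n. \<rho> (\<Phi> (x * (k n * a)))) \<longlonglongrightarrow> \<rho> (\<Phi> x * r)" by (simp add: b B.mult r)
    have "(\<lambda>n. norm (\<pi> x) * norm (\<pi> (k n * a) - \<pi> a)) \<longlonglongrightarrow> norm (\<pi> x) * 0"
      using k by (intro tendsto_mult tendsto_const) (simp add: LIM_zero_iff tendsto_norm_zero_iff)
    then have z: "(\<lambda>n. sqrt c * (norm (\<pi> x) * norm (\<pi> (k n * a) - \<pi> a))) \<longlonglongrightarrow> 0"
      by (auto intro: tendsto_mult_right_zero)
    have "(\<lambda>n. \<rho> (\<Phi> (x * (k n * a))) - \<rho> (\<Phi> (x * a))) \<longlonglongrightarrow> 0"
    proof (rule Lim_null_comparison[OF _ z], rule always_eventually, rule allI)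
      fix n
      have "\<rho> (\<Phi> (x * (k n * a))) - \<rho> (\<Phi> (x * a)) = \<rho> (\<Phi> (x * (k n * a - a)))"
        by (simp add: right_diff_distrib diff B.diff)
      then show "norm (\<rho> (\<Phi> (x * (k n * a))) - \<rho> (\<Phi> (x * a)))
          \<le> sqrt c * (norm (\<pi> x) * norm (\<pi> (k n * a) - \<pi> a))"
        using c norm_blinfun_compose[of "\<pi> x" "\<pi> (k n * a - a)"]
        by (simp add: norm_eq A.mult[of x] A.diff)
    qed
    then have "(\<lambda>n. \<rho> (\<Phi> (x * (k n * a)))) \<longlonglongrightarrow> \<rho> (\<Phi> (x * a))" by (simp add: LIM_zero_iff)
    with 1 have "\<rho> (\<Phi> (x * a)) = \<rho> (\<Phi> x * r)" using LIMSEQ_unique by blast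
    then show ?thesis by (simp add: B.eq_iff)
  qed
  then show ?thesis by blast
qed

definition \<Psi> :: "'a \<Rightarrow> 'b" where
  "\<Psi> a = (SOME b. \<forall>x. \<Phi> (x * a) = \<Phi> x * b)"

lemma mult_Psi: "\<Phi> (x * a) = \<Phi> x * \<Psi> a"
  using someI_ex[OF right_mult_implemented[of a]] unfolding \<Psi>_def by blast

lemma eq_Psi: assumes "\<And>x. \<Phi> (x * a) = \<Phi> x * b" shows "\<Psi> a = b"
proof (rule eq_if_all_left_mult_eq)
  fix z
  obtain x where "star z = \<Phi> x" by (rule surjE)
  then show "star z * \<Psi> a = star z * b" using assms[of x] mult_Psi[of x a] by simp
qed

lemma star_mult_Psi: "star (\<Phi> x) * \<Phi> y = c *\<^sub>R \<Psi> (star x * y)"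
proof -
  have "\<Psi> (star x * y) = inverse c *\<^sub>R (star (\<Phi> x) * \<Phi> y)"
  proof (rule eq_Psi)
    fix z show "\<Phi> (z * (star x * y)) = \<Phi> z * inverse c *\<^sub>R (star (\<Phi> x) * \<Phi> y)"
      using ternary[of z x y] c by (simp add: mult.assoc)
  qed
  then show ?thesis using c by simp
qed

lemma star_isomorphism_Psi: "star_isomorphism \<Psi>"
proof -
  have add_Psi: "\<Psi> (x + y) = \<Psi> x + \<Psi> y" for x y
    by (rule eq_Psi) (simp add: distrib_left add mult_Psi)
  have scale_Psi: "\<Psi> (d *\<^sub>C x) = d *\<^sub>C \<Psi> x" for d x
    by (rule eq_Psi) (simp add: mult_scaleC_right scaleC mult_Psi)
  have mult: "\<Psi> (x * y) = \<Psi> x * \<Psi> y" for x y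
    by (rule eq_Psi) (simp add: mult_Psi mult.assoc[symmetric])
  have star_Psi: "\<Psi> (star a) = star (\<Psi> a)" for a
  proof -
    define d where "d = star (\<Psi> a) - \<Psi> (star a)"
    \<comment> \<open>Both \<open>(\<Psi> a)*\<close> and \<open>\<Psi> (a*)\<close> describe the effect of \<open>x \<mapsto> x a\<close> on \<open>(\<Phi> x)* \<Phi> y\<close>.\<close>
    have "d * (star (\<Phi> x) * \<Phi> y) = 0" for x y
    proof -
      have "star (\<Psi> a) * (star (\<Phi> x) * \<Phi> y) = star (\<Phi> (x * a)) * \<Phi> y"
        by (simp add: mult_Psi star_mult mult.assoc)
      also have "\<dots> = \<Psi> (star a) * (c *\<^sub>R \<Psi> (star x * y))"
        by (simp add: star_mult_Psi star_mult mult mult.assoc)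
      also have "\<dots> = \<Psi> (star a) * (star (\<Phi> x) * \<Phi> y)" by (simp add: star_mult_Psi)
      finally show ?thesis by (simp add: d_def left_diff_distrib)
    qed
    then have "d * (star u * v) = 0" for u v by (metis surjE)
    from this[of d "d * star d"] have "star (d * star d) * (d * star d) = 0"
      by (simp add: star_mult star_star mult.assoc)
    then have "d = 0" by simp
    then show ?thesis by (simp add: d_def)
  qed
  have "inj \<Psi>"
  proof (rule injI)
    fix a a' assume eq: "\<Psi> a = \<Psi> a'"
    show "a = a'"
    proof (rule eq_if_all_left_mult_eq)
      fix z
      have "\<Phi> (star z * a) = \<Phi> (star z * a')" by (simp add: mult_Psi eq)
      then show "star z * a = star z * a'" by (simp add: eq_iff)
    qed
  qed
  moreover have "\<exists>a. b = \<Psi> a" for b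
  proof -
    interpret inv: ternary_isomorphism \<rho> \<pi> "inv \<Phi>" "inverse c" by (rule inverse)
    obtain a where a: "\<And>y. inv \<Phi> (y * b) = inv \<Phi> y * a" using inv.right_mult_implemented by blast
    have "\<Psi> a = b"
    proof (rule eq_Psi)
      fix x
      have "inv \<Phi> (\<Phi> x * b) = x * a" using a[of "\<Phi> x"] bij by (simp add: bij_is_inj)
      then show "\<Phi> (x * a) = \<Phi> x * b" using bij by (metis bij_is_surj surj_f_inv_f)
    qed
    then show ?thesis by blast
  qed
  then have "surj \<Psi>" by (metis surjI surj_def)
  ultimately show ?thesis
    unfolding star_isomorphism_def clinear_def
    by (simp add: bij_def add_Psi scale_Psi mult star_Psi)
qed

end

section \<open>Unitary multipliers\<close>

lemma subspace_closure:
  fixes S :: "'v::real_normed_vector set"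
  assumes S: "subspace S"
  shows "subspace (closure S)"
proof (rule subspaceI)
  show "0 \<in> closure S" using subspace_0[OF S] closure_subset by blast
next
  fix x y assume "x \<in> closure S" "y \<in> closure S"
  then obtain f g where "\<forall>n. f n \<in> S" "f \<longlonglongrightarrow> x" "\<forall>n. g n \<in> S" "g \<longlonglongrightarrow> y"
    unfolding closure_sequential by blast
  then show "x + y \<in> closure S"
    unfolding closure_sequential
    by (intro exI[of _ "\<lambda>n. f n + g n"]) (auto intro: tendsto_add subspace_add[OF S])
next
  fix x and r :: real assume "x \<in> closure S"
  then obtain f where "\<forall>n. f n \<in> S" "f \<longlonglongrightarrow> x" unfolding closure_sequential by blast
  then show "r *\<^sub>R x \<in> closure S"
    unfolding closure_sequential
    by (intro exI[of _ "\<lambda>n. r *\<^sub>R f n"]) (auto intro: tendsto_scaleR subspace_scale[OF S])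
qed

context star_rep
begin

context
  assumes nondeg: "nondegenerate \<pi>"
begin

lemma eq_on_range:
  fixes S T :: "'h \<Rightarrow>\<^sub>L 'h"
  assumes "\<And>x u. S (\<pi> x u) = T (\<pi> x u)"
  shows "S u = T u"
proof -
  let ?G = "{\<pi> x u | x u. True}"
  let ?E = "{u. (S - T) u = 0}"
  have "subspace ?E" by (auto simp: subspace_def blinfun.add_right blinfun.scaleR_right)
  moreover have "?G \<subseteq> ?E" using assms by (auto simp: blinfun.diff_left)
  ultimately have "span ?G \<subseteq> ?E" by (rule span_minimal[rotated])
  moreover have "closed ?E" by (intro closed_Collect_eq continuous_intros)
  ultimately have "closure (span ?G) \<subseteq> ?E" by (rule closure_minimal)
  then have "(S - T) u = 0" using nondeg by (auto simp: nondegenerate_def)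
  then show ?thesis by (simp add: blinfun.diff_left)
qed

text \<open>
  The vectors \<open>(\<pi> x u, \<pi> (L x) u)\<close> of the product space satisfy
  \<open>\<langle>\<pi> (L x) u, \<pi> (L y) v\<rangle> = \<langle>u, \<pi> ((L x)* L y) v\<rangle> = \<langle>\<pi> x u, \<pi> y v\<rangle>\<close>, so all pairs in their
  closed span have components of equal norm. Hence this span is the graph of an isometry, which is
  defined everywhere because the vectors \<open>\<pi> x u\<close> span a dense subspace.
\<close>

lemma exists_isometry:
  assumes L: "\<And>x y. star (L x) * L y = star x * y"
  shows "\<exists>V :: 'h \<Rightarrow>\<^sub>L 'h. (\<forall>x u. V (\<pi> x u) = \<pi> (L x) u) \<and> (\<forall>u. norm (V u) = norm u)"
proof -
  define G where "G = {(\<pi> x u, \<pi> (L x) u) | x u. True}"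
  define M where "M = closure (span G)"
  have subM: "subspace M" unfolding M_def by (intro subspace_closure subspace_span)
  have G: "inner (snd z) (snd w) = inner (fst z) (fst w)" if "z \<in> G" "w \<in> G" for z w
  proof -
    from that obtain x u y v where zw: "z = (\<pi> x u, \<pi> (L x) u)" "w = (\<pi> y v, \<pi> (L y) v)"
      by (auto simp: G_def)
    have "inner (\<pi> (L x) u) (\<pi> (L y) v) = inner u (\<pi> (star (L x) * L y) v)"
      by (simp add: adj mult_apply)
    also have "\<dots> = inner (\<pi> x u) (\<pi> y v)" by (simp add: L adj mult_apply)
    finally show ?thesis by (simp add: zw)
  qed
  have sub1: "subspace {z. inner (snd z) (snd w) = inner (fst z) (fst w)}" for w :: "'h \<times> 'h"
    by (auto simp: subspace_def inner_add_left)
  have "span G \<subseteq> {z. inner (snd z) (snd w) = inner (fst z) (fst w)}" if "w \<in> G" for w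
    using G that by (intro span_minimal sub1) auto
  then have "G \<subseteq> {w. inner (snd w) (snd z) = inner (fst w) (fst z)}" if "z \<in> span G" for z
    using that by (auto simp: inner_commute)
  then have "span G \<subseteq> {w. inner (snd w) (snd z) = inner (fst w) (fst z)}" if "z \<in> span G" for z
    using that by (intro span_minimal sub1) auto
  then have "span G \<subseteq> {z. norm (snd z) = norm (fst z)}" by (auto simp: norm_eq_sqrt_inner)
  moreover have "closed {z::'h \<times> 'h. norm (snd z) = norm (fst z)}"
    by (intro closed_Collect_eq continuous_intros)
  ultimately have "M \<subseteq> {z. norm (snd z) = norm (fst z)}" unfolding M_def by (rule closure_minimal)
  then have nM: "norm (snd z) = norm (fst z)" if "z \<in> M" for z
    using that by auto
  have "\<exists>v. (u, v) \<in> M" for u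
  proof -
    have "fst ` G = {\<pi> x u | x u. True}" by (force simp: G_def image_iff)
    then have "closure (fst ` span G) = UNIV"
      using nondeg linear_span_image[OF linear_fst, of G] by (simp add: nondegenerate_def)
    then obtain f where f: "\<And>n::nat. f n \<in> fst ` span G" "f \<longlonglongrightarrow> u"
      using closure_sequential by blast
    then have "\<exists>g. (f n, g) \<in> span G" for n by force
    then obtain g where g: "\<And>n. (f n, g n) \<in> span G" by metis
    have gM: "(f n, g n) \<in> M" for n using g closure_subset unfolding M_def by blast
    have "Cauchy g"
    proof (rule CauchyI)
      fix e :: real assume "0 < e"
      have "norm (g m - g n) = norm (f m - f n)" for m n
        using nM[OF subspace_diff[OF subM gM[of m] gM[of n]]] by simp
      then show "\<exists>N. \<forall>m\<ge>N. \<forall>n\<ge>N. norm (g m - g n) < e"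
        using CauchyD[OF LIMSEQ_imp_Cauchy[OF f(2)] \<open>0 < e\<close>] by simp
    qed
    then obtain v where "g \<longlonglongrightarrow> v" by (meson Cauchy_convergent convergent_def)
    then have lim: "(\<lambda>n. (f n, g n)) \<longlonglongrightarrow> (u, v)" using f(2) by (intro tendsto_Pair)
    have "closed M" by (simp add: M_def)
    from closed_sequentially[OF this gM lim] have "(u, v) \<in> M" .
    then show ?thesis by blast
  qed
  then obtain F where F: "\<And>u. (u, F u) \<in> M" by metis
  have uniq: "v = F u" if "(u, v) \<in> M" for u v
    using nM[OF subspace_diff[OF subM that F[of u]]] by simp
  have "F (u + v) = F u + F v" for u v
    using uniq[of "u + v" "F u + F v"] subspace_add[OF subM F[of u] F[of v]] by simp
  moreover have "F (r *\<^sub>R u) = r *\<^sub>R F u" for r u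
    using uniq[of "r *\<^sub>R u" "r *\<^sub>R F u"] subspace_scale[OF subM F[of u], of r] by simp
  moreover have nF: "norm (F u) = norm u" for u using nM[OF F[of u]] by simp
  ultimately have "bounded_linear F" by (intro bounded_linear_intro[where K = 1]) simp_all
  then have V: "blinfun_apply (Blinfun F) = F" by (rule bounded_linear_Blinfun_apply)
  have "F (\<pi> x u) = \<pi> (L x) u" for x u
  proof -
    have "(\<pi> x u, \<pi> (L x) u) \<in> G" by (auto simp: G_def)
    then have "(\<pi> x u, \<pi> (L x) u) \<in> M" unfolding M_def using span_superset closure_subset by blast
    then show ?thesis using uniq by simp
  qed
  with V nF show ?thesis by (intro exI[of _ "Blinfun F"]) simp
qed

text \<open>
  The isometries for \<open>L\<close> and for its inverse are inverse to each other, hence adjoint to each other. The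
  first, \<open>V\<close>, is a right multiplier as well: \<open>\<pi> x V\<close> is the adjoint of \<open>V* \<pi> (x*)\<close>, and \<open>V*\<close>
  belongs to the inverse of \<open>L\<close>.
\<close>

lemma unitary_multiplier:
  assumes bij: "bij L" and L: "\<And>x y. star (L x) * L y = star x * y"
  shows "\<exists>V \<in> multiplier_algebra \<pi>. unitary_op V \<and> (\<forall>x. multiplier_mult \<pi> V x = L x)"
proof -
  define L' where "L' = inv L"
  have LL: "L (L' x) = x" "L' (L x) = x" for x
    using bij by (simp_all add: L'_def bij_is_inj bij_is_surj surj_f_inv_f)
  have L': "star (L' x) * L' y = star x * y" for x y using L[of "L' x" "L' y"] by (simp add: LL)
  obtain V :: "'h \<Rightarrow>\<^sub>L 'h" where V: "\<And>x u. V (\<pi> x u) = \<pi> (L x) u" and nV: "\<And>u. norm (V u) = norm u"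
    using exists_isometry[of L] L by blast
  obtain W :: "'h \<Rightarrow>\<^sub>L 'h" where W: "\<And>x u. W (\<pi> x u) = \<pi> (L' x) u"
    using exists_isometry[of L'] L' by blast
  have "(W o\<^sub>L V) u = id_blinfun u" "(V o\<^sub>L W) u = id_blinfun u" for u
    by (rule eq_on_range, simp add: V W LL)+
  then have WV: "W (V u) = u" "V (W u) = u" for u by simp_all
  \<comment> \<open>Bounded operators are only real-linear by type; on the vectors \<open>\<pi> x u\<close> complex homogeneity is
     inherited from \<open>\<pi> (L x)\<close>.\<close>
  have V_scaleC: "V (c *\<^sub>C u) = c *\<^sub>C V u" for c u
  proof -
    have nc: "norm (c *\<^sub>C v) = cmod c * norm v" for v :: 'h
    proof -
      have "cinner (c *\<^sub>C v) (c *\<^sub>C v) = complex_of_real ((cmod c)\<^sup>2) * cinner v v"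
        unfolding complex_norm_square cinner_scaleC_left cinner_scaleC_right by (simp add: mult.assoc)
      moreover have "(norm w)\<^sup>2 = Re (cinner w w)" for w :: 'h
        by (simp add: power2_norm_eq_inner inner_eq_Re_cinner)
      ultimately have "(norm (c *\<^sub>C v))\<^sup>2 = (cmod c * norm v)\<^sup>2"
        by (simp add: power_mult_distrib del: of_real_power)
      then show ?thesis by simp
    qed
    have "bounded_linear (\<lambda>v::'h. c *\<^sub>C v)"
      by (intro bounded_linear_intro[where K = "cmod c"])
        (simp_all add: scaleC_add_right nc scaleR_scaleC scaleC_scaleC mult.commute)
    then have J: "blinfun_apply (Blinfun (\<lambda>v::'h. c *\<^sub>C v)) = (\<lambda>v. c *\<^sub>C v)"
      by (rule bounded_linear_Blinfun_apply)
    have "(V o\<^sub>L Blinfun (\<lambda>v. c *\<^sub>C v)) u = (Blinfun (\<lambda>v. c *\<^sub>C v) o\<^sub>L V) u"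
      by (rule eq_on_range) (simp add: J V apply_scaleC[symmetric])
    then show ?thesis by (simp add: J)
  qed
  have "inner (V u) (V v) = inner u v" for u v
    using nV[of "u + v"] nV[of u] nV[of v] by (simp add: dot_norm blinfun.add_right[symmetric])
  from this[of _ "W _"] have Vadj: "inner (V u) v = inner u (W v)" for u v by (simp add: WV)
  have Vcadj: "cinner (V u) v = cinner u (W v)" for u v
  proof -
    have "Im z = - Re (\<i> * z)" for z by simp
    then have "Im (cinner (V u) v) = Im (cinner u (W v))"
      using Vadj[of "\<i> *\<^sub>C u" v] by (simp only: V_scaleC inner_eq_Re_cinner cinner_scaleC_left)
    moreover have "Re (cinner (V u) v) = Re (cinner u (W v))"
      using Vadj[of u v] by (simp add: inner_eq_Re_cinner)
    ultimately show ?thesis by (simp add: complex_eq_iff)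
  qed
  have V_ops: "V \<in> bounded_ops" by (simp add: bounded_ops_def clinear_def blinfun.add_right V_scaleC)
  have "unitary_op V"
    unfolding unitary_op_def is_adjoint_def
    by (intro conjI V_ops exI[of _ W]) (auto intro!: blinfun_eqI simp: Vcadj WV)
  moreover have left: "V o\<^sub>L \<pi> x = \<pi> (L x)" for x by (intro blinfun_eqI) (simp add: V)
  moreover have right: "\<pi> x o\<^sub>L V = \<pi> (star (L' (star x)))" for x
  proof (intro blinfun_eqI)
    fix u
    have "inner (\<pi> x (V u)) v = inner (\<pi> (star (L' (star x))) u) v" for v
      by (simp add: adj Vadj W star_star)
    then have "inner (\<pi> x (V u) - \<pi> (star (L' (star x))) u) v = 0" for v
      by (simp add: inner_diff_left)
    then have "\<pi> x (V u) = \<pi> (star (L' (star x))) u" by (metis inner_eq_zero_iff eq_iff_diff_eq_0)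
    then show "(\<pi> x o\<^sub>L V) u = \<pi> (star (L' (star x))) u" by simp
  qed
  ultimately show ?thesis
    by (intro bexI[of _ V]) (auto simp: multiplier_algebra_def multiplier_mult_def V_ops inj)
qed

end

end

section \<open>The structure of linear strong Birkhoff--James isomorphisms\<close>

theorem corollary3p33:
  fixes \<Phi> :: "'a::cstar_algebra \<Rightarrow> 'b::cstar_algebra"
    and \<pi> :: "'a \<Rightarrow> ('k::chilbert_space \<Rightarrow>\<^sub>L 'k)"
    and \<rho> :: "'b \<Rightarrow> ('l::chilbert_space \<Rightarrow>\<^sub>L 'l)"
  assumes "compact_cstar_algebra TYPE('a) TYPE('g::chilbert_space)"
    and "compact_cstar_algebra TYPE('b) TYPE('h::chilbert_space)"
    and "faithful_nondegenerate_rep \<pi>"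
    and "faithful_nondegenerate_rep \<rho>"
    and "clinear \<Phi>"
    and "strong_BJ_isomorphism \<Phi>"
  shows "\<exists>\<alpha> \<beta> \<Psi> V W. \<alpha> \<noteq> 0 \<and> \<beta> \<noteq> 0 \<and> star_isomorphism \<Psi> \<and>
           V \<in> multiplier_algebra \<pi> \<and> unitary_op V \<and>
           W \<in> multiplier_algebra \<rho> \<and> unitary_op W \<and>
           (\<forall>x. \<Phi> x = \<alpha> *\<^sub>C \<Psi> (multiplier_mult \<pi> V x) \<and>
                \<Phi> x = \<beta> *\<^sub>C multiplier_mult \<rho> W (\<Psi> x))"
proof -
  obtain \<sigma> :: "'a \<Rightarrow> ('g \<Rightarrow>\<^sub>L 'g)" where \<sigma>: "compact_rep \<sigma>"
    using compact_cstar_algebra_rep[OF assms(1)] by blast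
  obtain \<tau> :: "'b \<Rightarrow> ('h \<Rightarrow>\<^sub>L 'h)" where \<tau>: "compact_rep \<tau>"
    using compact_cstar_algebra_rep[OF assms(2)] by blast
  interpret BJ: linear_strong_BJ_iso \<Phi>
    by (rule linear_strong_BJ_iso.intro[OF compact_rep.minproj_faithful[OF \<sigma>]
          compact_rep.minproj_faithful[OF \<tau>] assms(5,6)])
  obtain c where c: "c > 0"
    and ternary: "\<And>x y z. \<Phi> z * star (\<Phi> x) * \<Phi> y = c *\<^sub>R \<Phi> (z * star x * y)"
    using BJ.ternary by blast
  interpret T: ternary_isomorphism \<sigma> \<tau> \<Phi> c
    using \<sigma> \<tau> assms(5) BJ.bij c ternary
    by (intro ternary_isomorphism.intro ternary_isomorphism_axioms.intro)
  define \<Psi> where "\<Psi> = T.\<Psi>"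
  have \<Psi>: "star_isomorphism \<Psi>" unfolding \<Psi>_def by (rule T.star_isomorphism_Psi)
  then have \<Psi>_bij: "bij \<Psi>"
    and \<Psi>_mult: "\<And>x y. \<Psi> (x * y) = \<Psi> x * \<Psi> y" and \<Psi>_star: "\<And>x. \<Psi> (star x) = star (\<Psi> x)"
    by (auto simp: star_isomorphism_def)
  have \<Phi>\<Psi>: "star (\<Phi> x) * \<Phi> y = c *\<^sub>R \<Psi> (star x * y)" for x y
    unfolding \<Psi>_def by (rule T.star_mult_Psi)
  have inv_\<Psi>: "\<Psi> (inv \<Psi> y) = y" "inv \<Psi> (\<Psi> x) = x" for x y
    using \<Psi>_bij by (simp_all add: bij_is_inj bij_is_surj surj_f_inv_f)
  have inv_\<Phi>: "\<Phi> (inv \<Phi> y) = y" "inv \<Phi> (\<Phi> x) = x" for x y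
    using BJ.bij by (simp_all add: bij_is_inj bij_is_surj surj_f_inv_f)
  define s where "s = sqrt c"
  have s: "s > 0" "s * s = c" using c by (simp_all add: s_def)
  have sc: "inverse s * inverse s * c = 1" unfolding s(2)[symmetric] using s(1) by (simp add: field_simps)
  \<comment> \<open>Identifying the two algebras through \<open>\<Psi>\<close> turns \<open>\<Phi>\<close>, divided by \<open>s\<close>, into a map of either
     algebra to itself that preserves the products \<open>x* y\<close>.\<close>
  define L where "L x = inv \<Psi> (inverse s *\<^sub>R \<Phi> x)" for x
  define M where "M y = inverse s *\<^sub>R \<Phi> (inv \<Psi> y)" for y
  have "bij L"
    by (rule o_bij[where g = "\<lambda>y. inv \<Phi> (s *\<^sub>R \<Psi> y)"])
      (use s in \<open>auto simp: fun_eq_iff L_def inv_\<Psi> inv_\<Phi>\<close>)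
  moreover have "star (L x) * L y = star x * y" for x y
  proof -
    have "\<Psi> (star (L x) * L y) = (inverse s * inverse s) *\<^sub>R (star (\<Phi> x) * \<Phi> y)"
      by (simp add: L_def \<Psi>_mult \<Psi>_star inv_\<Psi> star_scaleR)
    also have "\<dots> = \<Psi> (star x * y)" by (simp add: \<Phi>\<Psi> sc)
    finally show ?thesis by (metis inv_\<Psi>(2))
  qed
  moreover have "star_rep \<pi>" "nondegenerate \<pi>"
    using assms(3) by (auto simp: faithful_nondegenerate_rep_def intro: star_rep.intro)
  ultimately obtain V where V: "V \<in> multiplier_algebra \<pi>" "unitary_op V" "\<And>x. multiplier_mult \<pi> V x = L x"
    using star_rep.unitary_multiplier by blast
  have "bij M"
    by (rule o_bij[where g = "\<lambda>y. \<Psi> (inv \<Phi> (s *\<^sub>R y))"])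
      (use s in \<open>auto simp: fun_eq_iff M_def inv_\<Psi> inv_\<Phi>\<close>)
  moreover have "star (M x) * M y = star x * y" for x y
  proof -
    have "star (M x) * M y = (inverse s * inverse s) *\<^sub>R (c *\<^sub>R (star x * y))"
      by (simp add: M_def star_scaleR \<Phi>\<Psi> \<Psi>_mult \<Psi>_star inv_\<Psi>)
    then show ?thesis by (simp add: sc)
  qed
  moreover have "star_rep \<rho>" "nondegenerate \<rho>"
    using assms(4) by (auto simp: faithful_nondegenerate_rep_def intro: star_rep.intro)
  ultimately obtain W where W: "W \<in> multiplier_algebra \<rho>" "unitary_op W" "\<And>x. multiplier_mult \<rho> W x = M x"
    using star_rep.unitary_multiplier by blast
  have "\<Phi> x = complex_of_real s *\<^sub>C \<Psi> (multiplier_mult \<pi> V x)"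
    and "\<Phi> x = complex_of_real s *\<^sub>C multiplier_mult \<rho> W (\<Psi> x)" for x
    using s by (simp_all add: V W L_def M_def inv_\<Psi> scaleC_of_real)
  with s \<Psi> V W show ?thesis
    by (intro exI[of _ "complex_of_real s"] exI[of _ \<Psi>] exI[of _ V] exI[of _ W]) auto
qed

end
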